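(* Suppose that $\mathfrak{F}$ is a saturated formation with $\mathfrak{N}\subseteq\mathfrak{F}$. Let $G$ be a finite solvable group and let $H$ be an $\mathfrak{F}$-projector of $G$. Put $K_0=G^{\mathfrak{F}}$ and $L_0=K_0'$, and for $i\ge 1$ put $K_i=(L_{i-1}H)^{\mathfrak{F}}$ and $L_i=K_i'$; let $m\ge 0$ be the least integer with $K_mH=H$ (so $K_m=1$). Let $\chi\in\mathrm{Irr}(G)$. Then $\chi\in\mathrm{Irr}_{\mathfrak{F}'}(G)$ if and only if the following two conditions hold. (a) The character $\chi_{K_0}$ is irreducible. Denote $\theta_0=\chi_{K_0}$. (b) There exist characters $\varphi_i\in\mathrm{Irr}(L_i)$ and $\theta_i\in\mathrm{Irr}(K_i\mid\varphi_i)$ for $0\le i\le m-1$ (with $\theta_0=\chi_{K_0}$), extending to $L_iH$ and $K_iH$ respectively, such that, with $\theta_m=1_{K_m}$, $$(1,1)=(K_m,\theta_m)\triangleleft(L_{m-1},\varphi_{m-1})\triangleleft\cdots\triangleleft(K_1,\theta_1)\triangleleft(L_0,\varphi_0)\triangleleft(K_0,\theta_0)\triangleleft(K_0H,\chi)=(G,\chi),$$ and $(\varphi_i)_{K_{i+1}}=\theta_{i+1}$ for $0\le i\le m-1$.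
   Context: All groups are finite and characters are complex; $X'$ denotes the derived subgroup of $X$. A formation is a class $\mathfrak{F}$ of finite groups closed under quotients such that $X/N,X/M\in\mathfrak{F}$ (with $N,M\trianglelefteq X$) implies $X/(M\cap N)\in\mathfrak{F}$; it is saturated if $X\in\mathfrak{F}\iff X/\Phi(X)\in\mathfrak{F}$, where $\Phi(X)$ is the Frattini subgroup. $\mathfrak{N}$ is the class of finite nilpotent groups. An $\mathfrak{F}$-projector of a solvable group $G$ is a subgroup $H$ such that for every $N\trianglelefteq G$: $HN/N\in\mathfrak{F}$, and if $HN/N\le V/N\le G/N$ with $V/N\in\mathfrak{F}$ then $HN=V$. For saturated $\mathfrak{F}$, $\mathfrak{F}$-projectors of $G$ exist, form one conjugacy class, and $H$ is an $\mathfrak{F}$-projector of every subgroup containing it. $G^{\mathfrak{F}}$ (the $\mathfrak{F}$-residual) is the smallest normal subgroup of $G$ with quotient in $\mathfrak{F}$. $\mathrm{Irr}(X\mid\varphi)$ is the set of irreducible characters of $X$ lying over $\varphi$; for a set $\Delta$ of irreducible characters, $\mathrm{Irr}(X\mid\Delta)=\bigcup_{\lambda\in\Delta}\mathrm{Irr}(X\mid\lambda)$. The notation $(N,\varphi)\triangleleft(M,\theta)$ means that $N\trianglelefteq M$ and the irreducible character $\theta$ of $M$ lies over the irreducible character $\varphi$ of $N$. Definition of $\mathrm{Irr}_{\mathfrak{F}'}(G)$ (the $\mathfrak{F}'$-characters of $G$), for $\mathfrak{N}\subseteq\mathfrak{F}$ and $G$ solvable with $\mathfrak{F}$-projector $H$.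 With $K_i,L_i$ as in the claim, one has $G=K_0H$, $K_i\le L_{i-1}$ and $K_iH=L_{i-1}H$ for $i\ge1$, and $G=K_0H>L_0H=K_1H>\cdots>L_{m-1}H=K_mH=H$. Put $\mathrm{Irr}_{\mathfrak{F}'}(H)=\mathrm{Lin}(H)$, the set of linear characters of $H$. Recursively for $i=m-1,m-2,\dots,0$, put $\Delta_i=\{\psi_{L_i}\mid\psi\in\mathrm{Irr}_{\mathfrak{F}'}(L_iH)\}\subseteq\mathrm{Irr}(L_i)$ and $\mathrm{Irr}_{\mathfrak{F}'}(K_iH)=\{\psi\in\mathrm{Irr}(K_iH\mid\Delta_i)\mid\psi_{K_i}\in\mathrm{Irr}(K_i)\}$. For $i=0$ this gives $\mathrm{Irr}_{\mathfrak{F}'}(G)$. *)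

theory Defs
  imports
    "HOL-Algebra.Solvable_Groups"
    "Jordan_Normal_Form.VS_Connect"
begin

section \<open>Characters\<close>

text \<open>
  The zero-dimensional representation is allowed here; it is excluded in the definition of
  irreducibility. A character is an extensional function on the carrier, so that
  \<^term>\<open>restrict \<chi> K\<close> is the restriction of a character to a subgroup \<open>K\<close>.
\<close>

definition representation :: "('a, 'b) monoid_scheme \<Rightarrow> nat \<Rightarrow> ('a \<Rightarrow> complex mat) \<Rightarrow> bool" where
  "representation X n \<rho> \<longleftrightarrow> \<rho> \<in> hom X (units_of (ring_mat TYPE(complex) n ()))"

definition irreducible_representation ::
  "('a, 'b) monoid_scheme \<Rightarrow> nat \<Rightarrow> ('a \<Rightarrow> complex mat) \<Rightarrow> bool" where
  "irreducible_representation X n \<rho> \<longleftrightarrow>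
     representation X n \<rho> \<and> n > 0 \<and>
     (\<forall>W. subspace class_ring W (module_vec TYPE(complex) n) \<and>
          (\<forall>x\<in>carrier X. \<forall>w\<in>W. \<rho> x *\<^sub>v w \<in> W)
        \<longrightarrow> W = {0\<^sub>v n} \<or> W = carrier_vec n)"

definition mat_trace :: "'a::comm_monoid_add mat \<Rightarrow> 'a" where
  "mat_trace A = (\<Sum>i<dim_row A. A $$ (i, i))"

definition afforded_character ::
  "('a, 'b) monoid_scheme \<Rightarrow> ('a \<Rightarrow> complex mat) \<Rightarrow> 'a \<Rightarrow> complex" where
  "afforded_character X \<rho> = (\<lambda>x\<in>carrier X. mat_trace (\<rho> x))"

definition Irr :: "('a, 'b) monoid_scheme \<Rightarrow> ('a \<Rightarrow> complex) set" where
  "Irr X = {afforded_character X \<rho> | n \<rho>. irreducible_representation X n \<rho>}"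

definition Lin :: "('a, 'b) monoid_scheme \<Rightarrow> ('a \<Rightarrow> complex) set" where
  "Lin X = {\<chi> \<in> Irr X. \<chi> \<one>\<^bsub>X\<^esub> = 1}"

definition char_inner :: "'a set \<Rightarrow> ('a \<Rightarrow> complex) \<Rightarrow> ('a \<Rightarrow> complex) \<Rightarrow> complex" where
  "char_inner N \<alpha> \<beta> = (\<Sum>x\<in>N. \<alpha> x * cnj (\<beta> x)) / of_nat (card N)"

text \<open>
  \<open>\<chi>\<close> lies over \<open>\<phi>\<close>: the irreducible character \<open>\<phi>\<close> of \<open>N\<close> is a constituent of the
  restriction of \<open>\<chi>\<close> to \<open>N\<close>.
\<close>

definition lies_over :: "'a set \<Rightarrow> ('a \<Rightarrow> complex) \<Rightarrow> ('a \<Rightarrow> complex) \<Rightarrow> bool" where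
  "lies_over N \<chi> \<phi> \<longleftrightarrow> char_inner N (restrict \<chi> N) \<phi> \<noteq> 0"

definition Irr_over ::
  "('a, 'b) monoid_scheme \<Rightarrow> 'a set \<Rightarrow> ('a \<Rightarrow> complex) \<Rightarrow> ('a \<Rightarrow> complex) set" where
  "Irr_over X N \<phi> = {\<chi> \<in> Irr X. lies_over N \<chi> \<phi>}"

definition Irr_over_set ::
  "('a, 'b) monoid_scheme \<Rightarrow> 'a set \<Rightarrow> ('a \<Rightarrow> complex) set \<Rightarrow> ('a \<Rightarrow> complex) set" where
  "Irr_over_set X N \<Delta> = (\<Union>\<phi>\<in>\<Delta>. Irr_over X N \<phi>)"

definition extends_to ::
  "('a, 'b) monoid_scheme \<Rightarrow> 'a set \<Rightarrow> ('a \<Rightarrow> complex) \<Rightarrow> bool" where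
  "extends_to X N \<phi> \<longleftrightarrow> (\<exists>\<psi>\<in>Irr X. restrict \<psi> N = \<phi>)"

definition trivial_character :: "'a set \<Rightarrow> 'a \<Rightarrow> complex" where
  "trivial_character N = (\<lambda>x\<in>N. 1)"

text \<open>The relation \<open>(N, \<phi>) \<lhd> (M, \<theta>)\<close> for subgroups \<open>N\<close>, \<open>M\<close> of \<open>G\<close>.\<close>

definition normal_pair ::
  "('a, 'b) monoid_scheme \<Rightarrow> 'a set \<times> ('a \<Rightarrow> complex) \<Rightarrow> 'a set \<times> ('a \<Rightarrow> complex) \<Rightarrow> bool" where
  "normal_pair G = (\<lambda>(N, \<phi>) (M, \<theta>).
     subgroup M G \<and> N \<lhd> G\<lparr>carrier := M\<rparr> \<and> \<phi> \<in> Irr (G\<lparr>carrier := N\<rparr>) \<and>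
     \<theta> \<in> Irr_over (G\<lparr>carrier := M\<rparr>) N \<phi>)"


section \<open>Saturated formations\<close>

text \<open>
  Every finite group is isomorphic to one whose elements are natural numbers. A class of finite
  groups is therefore represented by an isomorphism-closed set of groups over \<^typ>\<open>nat\<close>, and a
  finite group over any type belongs to it if it is isomorphic to one of these
  (\<open>in_group_class\<close>).
\<close>

definition group_class :: "nat monoid set \<Rightarrow> bool" where
  "group_class F \<longleftrightarrow>
     (\<forall>X\<in>F. group X \<and> finite (carrier X)) \<and>
     (\<forall>X\<in>F. \<forall>Y. group Y \<and> X \<cong> Y \<longrightarrow> Y \<in> F)"

definition in_group_class :: "('a, 'b) monoid_scheme \<Rightarrow> nat monoid set \<Rightarrow> bool" where
  "in_group_class X F \<longleftrightarrow> (\<exists>Y\<in>F. X \<cong> Y)"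

definition formation :: "nat monoid set \<Rightarrow> bool" where
  "formation F \<longleftrightarrow> group_class F \<and>
     (\<forall>X\<in>F. \<forall>N. N \<lhd> X \<longrightarrow> in_group_class (X Mod N) F) \<and>
     (\<forall>X :: nat monoid. group X \<and> finite (carrier X) \<longrightarrow>
        (\<forall>N M. N \<lhd> X \<and> M \<lhd> X \<and> in_group_class (X Mod N) F \<and> in_group_class (X Mod M) F
           \<longrightarrow> in_group_class (X Mod (M \<inter> N)) F))"

definition maximal_subgroup :: "'a set \<Rightarrow> ('a, 'b) monoid_scheme \<Rightarrow> bool" where
  "maximal_subgroup M X \<longleftrightarrow> subgroup M X \<and> M \<noteq> carrier X \<and>
     (\<forall>U. subgroup U X \<and> M \<subseteq> U \<longrightarrow> U = M \<or> U = carrier X)"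

text \<open>The trivial group has no maximal subgroup; its Frattini subgroup is the whole group.\<close>

definition frattini :: "('a, 'b) monoid_scheme \<Rightarrow> 'a set" where
  "frattini X = carrier X \<inter> \<Inter> {M. maximal_subgroup M X}"

definition saturated_formation :: "nat monoid set \<Rightarrow> bool" where
  "saturated_formation F \<longleftrightarrow> formation F \<and>
     (\<forall>X :: nat monoid. group X \<and> finite (carrier X) \<longrightarrow>
        (X \<in> F \<longleftrightarrow> in_group_class (X Mod frattini X) F))"

primrec lower_central :: "('a, 'b) monoid_scheme \<Rightarrow> nat \<Rightarrow> 'a set" where
  "lower_central X 0 = carrier X"
| "lower_central X (Suc n) =
     generate X {x \<otimes>\<^bsub>X\<^esub> y \<otimes>\<^bsub>X\<^esub> inv\<^bsub>X\<^esub> x \<otimes>\<^bsub>X\<^esub> inv\<^bsub>X\<^esub> y | x y.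
       x \<in> lower_central X n \<and> y \<in> carrier X}"

definition nilpotent :: "('a, 'b) monoid_scheme \<Rightarrow> bool" where
  "nilpotent X \<longleftrightarrow> (\<exists>n. lower_central X n = {\<one>\<^bsub>X\<^esub>})"

definition finite_nilpotent_groups :: "nat monoid set" where
  "finite_nilpotent_groups = {X. group X \<and> finite (carrier X) \<and> nilpotent X}"

definition projector :: "nat monoid set \<Rightarrow> ('a, 'b) monoid_scheme \<Rightarrow> 'a set \<Rightarrow> bool" where
  "projector F G H \<longleftrightarrow> subgroup H G \<and>
     (\<forall>N. N \<lhd> G \<longrightarrow>
        in_group_class (G\<lparr>carrier := H <#>\<^bsub>G\<^esub> N\<rparr> Mod N) F \<and>
        (\<forall>V. subgroup V G \<and> H <#>\<^bsub>G\<^esub> N \<subseteq> V \<and> in_group_class (G\<lparr>carrier := V\<rparr> Mod N) F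
           \<longrightarrow> H <#>\<^bsub>G\<^esub> N = V))"

text \<open>On sets, \<open>LEAST\<close> refers to inclusion.\<close>

definition residual :: "nat monoid set \<Rightarrow> ('a, 'b) monoid_scheme \<Rightarrow> 'a set" where
  "residual F X = (LEAST N. N \<lhd> X \<and> in_group_class (X Mod N) F)"


section \<open>The characters associated with a saturated formation\<close>

primrec chain_K :: "nat monoid set \<Rightarrow> ('a, 'b) monoid_scheme \<Rightarrow> 'a set \<Rightarrow> nat \<Rightarrow> 'a set" where
  "chain_K F G H 0 = residual F G"
| "chain_K F G H (Suc i) =
     residual F (G\<lparr>carrier := derived G (chain_K F G H i) <#>\<^bsub>G\<^esub> H\<rparr>)"

definition chain_L :: "nat monoid set \<Rightarrow> ('a, 'b) monoid_scheme \<Rightarrow> 'a set \<Rightarrow> nat \<Rightarrow> 'a set" where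
  "chain_L F G H i = derived G (chain_K F G H i)"

definition chain_length :: "nat monoid set \<Rightarrow> ('a, 'b) monoid_scheme \<Rightarrow> 'a set \<Rightarrow> nat" where
  "chain_length F G H = (LEAST m. chain_K F G H m <#>\<^bsub>G\<^esub> H = H)"

text \<open>
  \<open>Irr_F'_step F G H i\<close> is the set of \<open>F'\<close>-characters of \<open>K\<^sub>i H\<close>. For \<open>i = m\<close> this group is
  \<open>H\<close>; for \<open>i < m\<close> the recursive call yields the \<open>F'\<close>-characters of
  \<open>K\<^bsub>i+1\<^esub> H = L\<^sub>i H\<close>, and their restrictions to \<open>L\<^sub>i\<close> form the set \<open>\<Delta>\<^sub>i\<close>.
\<close>

function Irr_F'_step ::
  "nat monoid set \<Rightarrow> ('a, 'b) monoid_scheme \<Rightarrow> 'a set \<Rightarrow> nat \<Rightarrow> ('a \<Rightarrow> complex) set" where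
  "Irr_F'_step F G H i =
    (if chain_length F G H \<le> i then Lin (G\<lparr>carrier := H\<rparr>)
     else let K = chain_K F G H i;
              L = chain_L F G H i;
              \<Delta> = (\<lambda>\<psi>. restrict \<psi> L) ` Irr_F'_step F G H (Suc i)
          in {\<psi> \<in> Irr_over_set (G\<lparr>carrier := K <#>\<^bsub>G\<^esub> H\<rparr>) L \<Delta>.
                restrict \<psi> K \<in> Irr (G\<lparr>carrier := K\<rparr>)})"
  by pat_completeness auto
termination
  by (relation "Wellfounded.measure (\<lambda>(F, G, H, i). chain_length F G H - i)") auto

declare Irr_F'_step.simps [simp del]

definition Irr_F' ::
  "nat monoid set \<Rightarrow> ('a, 'b) monoid_scheme \<Rightarrow> 'a set \<Rightarrow> ('a \<Rightarrow> complex) set" where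
  "Irr_F' F G H = Irr_F'_step F G H 0"

end

theory Submission
  imports Defs "HOL-Algebra.Zassenhaus" "Jordan_Normal_Form.Spectral_Radius"
begin

text \<open>
  The recursive definition of the \<open>F'\<close>-characters and the chain condition carry the same
  information, once three facts are known.

  \<^item> The chain has the expected shape: \<open>K\<^sub>0 H = G\<close>, \<open>K\<^bsub>i+1\<^esub> \<subseteq> L\<^sub>i \<subseteq> K\<^sub>i\<close>,
    \<open>K\<^bsub>i+1\<^esub> H = L\<^sub>i H\<close> and \<open>K\<^sub>m = 1\<close>. Here \<open>K\<^bsub>i+1\<^esub> H = L\<^sub>i H\<close> says that \<open>H\<close> still supplements the
    residual in the smaller group \<open>L\<^sub>i H\<close>. This is where saturation and solvability enter
    (\<open>projector_in_subgroup\<close>).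
  \<^item> If the restriction of an irreducible character \<open>\<psi>\<close> of \<open>X\<close> to a subgroup \<open>K\<close> is irreducible, so is
    its restriction to every subgroup between \<open>K\<close> and \<open>X\<close> (\<open>Irr_restrict_intermediate\<close>). Hence a
    member \<open>\<psi>\<close> of \<open>Irr_F'\<close> for \<open>L\<^sub>i H = K\<^bsub>i+1\<^esub> H\<close> restricts irreducibly to \<open>L\<^sub>i\<close>.
  \<^item> Lying over a character of \<open>L\<^sub>i\<close> depends only on the restriction to \<open>K\<^sub>i \<supseteq> L\<^sub>i\<close>.

  Given an \<open>F'\<close>-character \<open>\<chi>\<close>, unfolding the recursion yields \<open>\<psi>\<^sub>0 = \<chi>, \<psi>\<^sub>1, \<dots>, \<psi>\<^sub>m\<close> with \<open>\<psi>\<^sub>i\<close> an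
  \<open>F'\<close>-character of \<open>K\<^sub>i H\<close> lying over the restriction of \<open>\<psi>\<^bsub>i+1\<^esub>\<close> to \<open>L\<^sub>i\<close>. The characters sought are
  \<open>\<theta>\<^sub>i = \<psi>\<^sub>i | K\<^sub>i\<close> and \<open>\<phi>\<^sub>i = \<psi>\<^bsub>i+1\<^esub> | L\<^sub>i\<close>, which extend to \<open>K\<^sub>i H\<close> and \<open>L\<^sub>i H\<close> by construction.

  Conversely, given \<open>\<phi>\<^sub>i\<close> and \<open>\<theta>\<^sub>i\<close>, downward induction on \<open>i\<close> shows that \<^emph>\<open>every\<close> extension of \<open>\<theta>\<^sub>i\<close>
  to \<open>K\<^sub>i H\<close> is an \<open>F'\<close>-character (\<open>extension_in_Irr_F'_step\<close>). For \<open>i = m\<close> the extensions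
  of the trivial character of \<open>K\<^sub>m = 1\<close> are the linear characters of \<open>H\<close>. For \<open>i < m\<close> an extension of
  \<open>\<phi>\<^sub>i\<close> to \<open>L\<^sub>i H = K\<^bsub>i+1\<^esub> H\<close> also extends \<open>\<theta>\<^bsub>i+1\<^esub>\<close>, so it is an \<open>F'\<close>-character by induction and \<open>\<phi>\<^sub>i\<close>
  belongs to \<open>\<Delta>\<^sub>i\<close>; an extension of \<open>\<theta>\<^sub>i\<close> lies over \<open>\<phi>\<^sub>i\<close> because \<open>\<theta>\<^sub>i\<close> does. Quantifying over all
  extensions makes it irrelevant which one is chosen, and \<open>\<chi>\<close> is an extension of \<open>\<theta>\<^sub>0\<close>.

  For the first fact, let \<open>H \<subseteq> V\<close> with \<open>V/N\<close> in the formation; the claim is \<open>V = H N\<close>. Descending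
  along the derived series of \<open>G\<close>, one gets \<open>V = H N B\<close>, where \<open>B\<close> is the intersection of \<open>V\<close> with a
  term of the series, hence normal in \<open>V\<close>, and abelian modulo the next term \<open>Z \<subseteq> N\<close>. Then \<open>H B/(N \<inter> B)\<close> is in the formation, and because \<open>H Z/Z\<close> is maximal
  among the subgroups of \<open>G/Z\<close> in the formation, \<open>maximal_in_class_supplements\<close> gives
  \<open>H B = H Z (N \<inter> B)\<close>, so \<open>B \<subseteq> H N\<close>.

  For the second fact it suffices that a representation with the character of an irreducible
  one is itself irreducible. Averaging the matrix units gives intertwiners between the two; they
  cannot all vanish, since a sum of their entries is the sum of \<open>\<chi>(g) \<chi>(g\<^sup>-\<^sup>1)\<close>, which Schur's lemma
  evaluates to the group order.
\<close>

section \<open>Irreducible representations and their characters\<close>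

lemma representationD:
  assumes "group X" "representation X n \<rho>"
  shows "\<And>x. x \<in> carrier X \<Longrightarrow> \<rho> x \<in> carrier_mat n n"
    and "\<And>x y. x \<in> carrier X \<Longrightarrow> y \<in> carrier X \<Longrightarrow> \<rho> (x \<otimes>\<^bsub>X\<^esub> y) = \<rho> x * \<rho> y"
    and "\<rho> \<one>\<^bsub>X\<^esub> = 1\<^sub>m n"
proof -
  let ?R = "ring_mat TYPE(complex) n ()"
  interpret R: ring ?R by (rule ring_mat)
  have hom: "\<rho> \<in> hom X (units_of ?R)"
    using assms(2) by (simp add: representation_def)
  show "\<rho> x \<in> carrier_mat n n" if "x \<in> carrier X" for x
    using hom that by (auto simp: hom_def units_of_def Units_def ring_mat_simps)
  show "\<rho> (x \<otimes>\<^bsub>X\<^esub> y) = \<rho> x * \<rho> y" if "x \<in> carrier X" "y \<in> carrier X" for x y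
    using hom that by (auto simp: hom_def units_of_def ring_mat_simps)
  show "\<rho> \<one>\<^bsub>X\<^esub> = 1\<^sub>m n"
    using hom_one[OF hom assms(1) R.units_group] by (simp add: units_of_def ring_mat_simps)
qed

lemma representation_subgroup:
  "representation X n \<rho> \<Longrightarrow> K \<subseteq> carrier X \<Longrightarrow> representation (X\<lparr>carrier := K\<rparr>) n \<rho>"
  by (auto simp: representation_def hom_def)

lemma mult_mat_entry:
  assumes "A \<in> carrier_mat n p" "B \<in> carrier_mat p r" "i < n" "j < r"
  shows "(A * B) $$ (i, j) = (\<Sum>k<p. A $$ (i, k) * B $$ (k, j))"
  using assms by (auto simp: scalar_prod_def atLeast0LessThan intro!: sum.cong)

lemma subspace_vec_iff:
  "VectorSpace.subspace class_ring W (module_vec TYPE(complex) n) \<longleftrightarrow>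
     W \<subseteq> carrier_vec n \<and> 0\<^sub>v n \<in> W \<and> (\<forall>v\<in>W. \<forall>w\<in>W. v + w \<in> W) \<and> (\<forall>c. \<forall>v\<in>W. c \<cdot>\<^sub>v v \<in> W)"
proof -
  have vs: "vectorspace class_ring (module_vec TYPE(complex) n)"
    by (rule vec_vs)
  then have "Module.module class_ring (module_vec TYPE(complex) n)"
    by (simp add: vectorspace_def)
  then show ?thesis
    using vs by (auto simp: VectorSpace.subspace_def submodule_def module_vec_simps)
qed

text \<open>
  The entries of \<open>\<Sum>\<^sub>g \<rho>(g) E\<^bsub>k l\<^esub> \<sigma>(g\<^sup>-\<^sup>1)\<close>, where \<open>E\<^bsub>k l\<^esub>\<close> is the matrix unit. Writing them out avoids sums
  of matrices.
\<close>

definition averaged_unit ::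
  "('a, 'b) monoid_scheme \<Rightarrow> nat \<Rightarrow> ('a \<Rightarrow> complex mat) \<Rightarrow> ('a \<Rightarrow> complex mat) \<Rightarrow> nat \<Rightarrow> nat \<Rightarrow> complex mat"
  where
  "averaged_unit X n \<rho> \<sigma> k l =
     mat n n (\<lambda>(i, j). \<Sum>g\<in>carrier X. \<rho> g $$ (i, k) * \<sigma> (inv\<^bsub>X\<^esub> g) $$ (l, j))"

lemma averaged_unit_carrier [simp]: "averaged_unit X n \<rho> \<sigma> k l \<in> carrier_mat n n"
  by (simp add: averaged_unit_def)

text \<open>Substituting \<open>h g\<close> for \<open>g\<close> in the sum moves \<open>h\<close> from one side of the matrix unit to the other.\<close>

lemma averaged_unit_intertwines:
  assumes X: "group X" and \<rho>: "representation X n \<rho>" and \<sigma>: "representation X n \<sigma>"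
    and h: "h \<in> carrier X" and kl: "k < n" "l < n"
  shows "\<rho> h * averaged_unit X n \<rho> \<sigma> k l = averaged_unit X n \<rho> \<sigma> k l * \<sigma> h"
proof (rule eq_matI)
  interpret group X by fact
  note R = representationD[OF X \<rho>] and S = representationD[OF X \<sigma>]
  let ?T = "averaged_unit X n \<rho> \<sigma> k l"
  fix i j assume "i < dim_row (?T * \<sigma> h)" "j < dim_col (?T * \<sigma> h)"
  then have ij: "i < n" "j < n"
    using S(1)[OF h] by (auto simp: averaged_unit_def)
  let ?f = "\<lambda>g. \<rho> g $$ (i, k) * \<sigma> (inv\<^bsub>X\<^esub> g \<otimes>\<^bsub>X\<^esub> h) $$ (l, j)"
  have "(\<rho> h * ?T) $$ (i, j)
      = (\<Sum>a<n. \<rho> h $$ (i, a) * (\<Sum>g\<in>carrier X. \<rho> g $$ (a, k) * \<sigma> (inv\<^bsub>X\<^esub> g) $$ (l, j)))"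
    using mult_mat_entry[OF R(1)[OF h] averaged_unit_carrier ij] ij by (simp add: averaged_unit_def)
  also have "\<dots> = (\<Sum>g\<in>carrier X. (\<Sum>a<n. \<rho> h $$ (i, a) * \<rho> g $$ (a, k)) * \<sigma> (inv\<^bsub>X\<^esub> g) $$ (l, j))"
    by (simp add: sum_distrib_left sum_distrib_right mult.assoc) (rule sum.swap)
  also have "\<dots> = (\<Sum>g\<in>carrier X. ?f (h \<otimes>\<^bsub>X\<^esub> g))"
  proof (rule sum.cong)
    fix g assume g: "g \<in> carrier X"
    have "inv\<^bsub>X\<^esub> (h \<otimes>\<^bsub>X\<^esub> g) \<otimes>\<^bsub>X\<^esub> h = inv\<^bsub>X\<^esub> g"
      using h g by (simp add: inv_mult_group m_assoc)
    then show "(\<Sum>a<n. \<rho> h $$ (i, a) * \<rho> g $$ (a, k)) * \<sigma> (inv\<^bsub>X\<^esub> g) $$ (l, j) = ?f (h \<otimes>\<^bsub>X\<^esub> g)"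
      using mult_mat_entry[OF R(1)[OF h] R(1)[OF g] ij(1) kl(1)] R(2)[OF h g] by simp
  qed simp
  also have "\<dots> = (\<Sum>g\<in>carrier X. ?f g)"
  proof (rule sum.reindex_bij_betw)
    show "bij_betw (\<lambda>g. h \<otimes>\<^bsub>X\<^esub> g) (carrier X) (carrier X)"
      by (rule bij_betw_byWitness[where f' = "\<lambda>g. inv\<^bsub>X\<^esub> h \<otimes>\<^bsub>X\<^esub> g"])
        (use h in \<open>auto simp: m_assoc[symmetric]\<close>)
  qed
  also have "\<dots> = (\<Sum>g\<in>carrier X. \<rho> g $$ (i, k) * (\<Sum>b<n. \<sigma> (inv\<^bsub>X\<^esub> g) $$ (l, b) * \<sigma> h $$ (b, j)))"
    using mult_mat_entry[OF S(1) S(1)[OF h] kl(2) ij(2)] S(2) h by (intro sum.cong) simp_all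
  also have "\<dots> = (\<Sum>b<n. (\<Sum>g\<in>carrier X. \<rho> g $$ (i, k) * \<sigma> (inv\<^bsub>X\<^esub> g) $$ (l, b)) * \<sigma> h $$ (b, j))"
    by (simp add: sum_distrib_left sum_distrib_right mult.assoc) (rule sum.swap)
  also have "\<dots> = (?T * \<sigma> h) $$ (i, j)"
    unfolding mult_mat_entry[OF averaged_unit_carrier S(1)[OF h] ij] using ij
    by (simp add: averaged_unit_def)
  finally show "(\<rho> h * ?T) $$ (i, j) = (?T * \<sigma> h) $$ (i, j)" .
next
  show "dim_row (\<rho> h * averaged_unit X n \<rho> \<sigma> k l) = dim_row (averaged_unit X n \<rho> \<sigma> k l * \<sigma> h)"
    using representationD(1)[OF X \<rho> h] by (simp add: averaged_unit_def)
  show "dim_col (\<rho> h * averaged_unit X n \<rho> \<sigma> k l) = dim_col (averaged_unit X n \<rho> \<sigma> k l * \<sigma> h)"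
    using representationD(1)[OF X \<sigma> h] by (simp add: averaged_unit_def)
qed

lemma sum_trace_trace:
  assumes X: "group X" and \<rho>: "representation X n \<rho>" and \<sigma>: "representation X n \<sigma>"
  shows "(\<Sum>g\<in>carrier X. mat_trace (\<rho> g) * mat_trace (\<sigma> (inv\<^bsub>X\<^esub> g)))
    = (\<Sum>k<n. \<Sum>l<n. averaged_unit X n \<rho> \<sigma> k l $$ (k, l))"
proof -
  interpret group X by fact
  have "mat_trace (\<rho> g) * mat_trace (\<sigma> (inv\<^bsub>X\<^esub> g))
      = (\<Sum>k<n. \<Sum>l<n. \<rho> g $$ (k, k) * \<sigma> (inv\<^bsub>X\<^esub> g) $$ (l, l))" if "g \<in> carrier X" for g
    using representationD(1)[OF X \<rho> that] representationD(1)[OF X \<sigma> inv_closed[OF that]]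
    by (simp add: mat_trace_def sum_product)
  then have "(\<Sum>g\<in>carrier X. mat_trace (\<rho> g) * mat_trace (\<sigma> (inv\<^bsub>X\<^esub> g)))
      = (\<Sum>g\<in>carrier X. \<Sum>k<n. \<Sum>l<n. \<rho> g $$ (k, k) * \<sigma> (inv\<^bsub>X\<^esub> g) $$ (l, l))"
    by (intro sum.cong) simp_all
  also have "\<dots> = (\<Sum>k<n. \<Sum>l<n. \<Sum>g\<in>carrier X. \<rho> g $$ (k, k) * \<sigma> (inv\<^bsub>X\<^esub> g) $$ (l, l))"
    by (subst sum.swap) (intro sum.cong refl sum.swap)
  finally show ?thesis
    by (simp add: averaged_unit_def)
qed

text \<open>Schur's lemma: the eigenspace of any eigenvalue of \<open>T\<close> is invariant, hence everything.\<close>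

lemma irreducible_commuting_scalar:
  assumes X: "group X" and irr: "irreducible_representation X n \<rho>"
    and T: "T \<in> carrier_mat n n" and comm: "\<And>h. h \<in> carrier X \<Longrightarrow> \<rho> h * T = T * \<rho> h"
  obtains c where "T = c \<cdot>\<^sub>m 1\<^sub>m n"
proof -
  have \<rho>: "representation X n \<rho>" and "n > 0"
    and inv: "\<And>W. VectorSpace.subspace class_ring W (module_vec TYPE(complex) n) \<Longrightarrow>
          (\<And>x w. x \<in> carrier X \<Longrightarrow> w \<in> W \<Longrightarrow> \<rho> x *\<^sub>v w \<in> W) \<Longrightarrow> W = {0\<^sub>v n} \<or> W = carrier_vec n"
    using irr by (auto simp: irreducible_representation_def)
  note R = representationD[OF X \<rho>]
  obtain c v where v: "v \<in> carrier_vec n" "v \<noteq> 0\<^sub>v n" "T *\<^sub>v v = c \<cdot>\<^sub>v v"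
    using spectrum_non_empty[OF T \<open>n > 0\<close>] T
    by (auto simp: spectrum_def eigenvalue_def eigenvector_def)
  define W where "W = {w \<in> carrier_vec n. T *\<^sub>v w = c \<cdot>\<^sub>v w}"
  have "W = {0\<^sub>v n} \<or> W = carrier_vec n"
  proof (rule inv)
    show "VectorSpace.subspace class_ring W (module_vec TYPE(complex) n)"
      using T unfolding subspace_vec_iff
      by (auto simp: W_def mult_add_distrib_mat_vec smult_add_distrib_vec mult_mat_vec smult_smult_assoc mult.commute)
  next
    fix x w assume x: "x \<in> carrier X" and w: "w \<in> W"
    have "T *\<^sub>v (\<rho> x *\<^sub>v w) = (\<rho> x * T) *\<^sub>v w"
      using R(1)[OF x] T w comm[OF x] by (simp add: W_def assoc_mult_mat_vec)
    also have "\<dots> = c \<cdot>\<^sub>v (\<rho> x *\<^sub>v w)"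
      using R(1)[OF x] T w by (simp add: W_def assoc_mult_mat_vec mult_mat_vec)
    finally show "\<rho> x *\<^sub>v w \<in> W"
      using R(1)[OF x] w by (simp add: W_def)
  qed
  moreover have "v \<in> W"
    using v by (simp add: W_def)
  ultimately have W: "W = carrier_vec n"
    using v(2) by auto
  have "T = c \<cdot>\<^sub>m 1\<^sub>m n"
  proof (rule eq_matI)
    fix i j assume "i < dim_row (c \<cdot>\<^sub>m 1\<^sub>m n :: complex mat)" "j < dim_col (c \<cdot>\<^sub>m 1\<^sub>m n :: complex mat)"
    then have ij: "i < n" "j < n" by auto
    have "unit_vec n j \<in> W"
      by (simp add: W)
    then have "(T *\<^sub>v unit_vec n j) $ i = (c \<cdot>\<^sub>v unit_vec n j) $ i"
      by (simp add: W_def)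
    then show "T $$ (i, j) = (c \<cdot>\<^sub>m 1\<^sub>m n) $$ (i, j)"
      using T ij by (auto simp: scalar_prod_right_unit)
  qed (use T in auto)
  then show thesis
    using that by blast
qed

text \<open>
  The averaged matrix units of one irreducible representation are scalar matrices by Schur's
  lemma, and the scalar is found by taking the trace. The sum turns out to be the group order.
\<close>

lemma irreducible_trace_sum:
  assumes X: "group X" and fin: "finite (carrier X)" and irr: "irreducible_representation X n \<rho>"
  shows "(\<Sum>g\<in>carrier X. mat_trace (\<rho> g) * mat_trace (\<rho> (inv\<^bsub>X\<^esub> g))) \<noteq> 0"
proof -
  interpret group X by fact
  have \<rho>: "representation X n \<rho>" and "n > 0"
    using irr by (auto simp: irreducible_representation_def)
  note R = representationD[OF X \<rho>]
  let ?T = "averaged_unit X n \<rho> \<rho>"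
  have entry: "?T k l $$ (k, l) = (if k = l then of_nat (card (carrier X)) / of_nat n else 0)"
    if kl: "k < n" "l < n" for k l
  proof -
    obtain c where c: "?T k l = c \<cdot>\<^sub>m 1\<^sub>m n"
      using irreducible_commuting_scalar[OF X irr averaged_unit_carrier]
        averaged_unit_intertwines[OF X \<rho> \<rho> _ kl] by metis
    have "of_nat n * c = (\<Sum>i<n. ?T k l $$ (i, i))"
      by (simp add: c)
    also have "\<dots> = (\<Sum>g\<in>carrier X. \<Sum>i<n. \<rho> (inv\<^bsub>X\<^esub> g) $$ (l, i) * \<rho> g $$ (i, k))"
      by (subst sum.swap) (simp add: averaged_unit_def mult.commute)
    also have "\<dots> = (\<Sum>g\<in>carrier X. 1\<^sub>m n $$ (l, k))"
    proof (rule sum.cong)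
      fix g assume g: "g \<in> carrier X"
      have "(\<Sum>i<n. \<rho> (inv\<^bsub>X\<^esub> g) $$ (l, i) * \<rho> g $$ (i, k)) = \<rho> (inv\<^bsub>X\<^esub> g \<otimes>\<^bsub>X\<^esub> g) $$ (l, k)"
        using mult_mat_entry[OF R(1)[OF inv_closed[OF g]] R(1)[OF g] kl(2,1)]
          R(2)[OF inv_closed[OF g] g] by metis
      then show "(\<Sum>i<n. \<rho> (inv\<^bsub>X\<^esub> g) $$ (l, i) * \<rho> g $$ (i, k)) = 1\<^sub>m n $$ (l, k)"
        using g R(3) by simp
    qed simp
    also have "\<dots> = (if k = l then of_nat (card (carrier X)) else 0)"
      using kl by simp
    finally have "c = (if k = l then of_nat (card (carrier X)) / of_nat n else 0)"
      using \<open>n > 0\<close> by (auto simp: field_simps)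
    then show ?thesis
      using kl by (simp add: c)
  qed
  have "(\<Sum>g\<in>carrier X. mat_trace (\<rho> g) * mat_trace (\<rho> (inv\<^bsub>X\<^esub> g)))
      = (\<Sum>k<n. \<Sum>l<n. if k = l then of_nat (card (carrier X)) / of_nat n else 0)"
    unfolding sum_trace_trace[OF X \<rho> \<rho>] by (intro sum.cong refl) (simp add: entry)
  also have "\<dots> = of_nat (card (carrier X))"
    using \<open>n > 0\<close> by simp
  finally show ?thesis
    using fin one_closed by auto
qed

text \<open>
  The kernel of a nonzero intertwiner is a proper invariant subspace of the irreducible
  representation, so a square intertwiner is invertible and preimages under it carry
  invariant subspaces of \<open>\<rho>\<close> to invariant subspaces of \<open>\<sigma>\<close>.
\<close>

lemma irreducible_equivalent:
  assumes X: "group X" and \<rho>: "representation X n \<rho>" and irr: "irreducible_representation X n \<sigma>"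
    and T: "T \<in> carrier_mat n n" "T \<noteq> 0\<^sub>m n n"
    and comm: "\<And>h. h \<in> carrier X \<Longrightarrow> \<rho> h * T = T * \<sigma> h"
  shows "irreducible_representation X n \<rho>"
proof -
  have \<sigma>: "representation X n \<sigma>" and "n > 0"
    and inv: "\<And>W. VectorSpace.subspace class_ring W (module_vec TYPE(complex) n) \<Longrightarrow>
          (\<And>x w. x \<in> carrier X \<Longrightarrow> w \<in> W \<Longrightarrow> \<sigma> x *\<^sub>v w \<in> W) \<Longrightarrow> W = {0\<^sub>v n} \<or> W = carrier_vec n"
    using irr by (auto simp: irreducible_representation_def)
  note R = representationD[OF X \<rho>] and S = representationD[OF X \<sigma>]
  have commv: "T *\<^sub>v (\<sigma> x *\<^sub>v w) = \<rho> x *\<^sub>v (T *\<^sub>v w)" if "x \<in> carrier X" "w \<in> carrier_vec n" for x w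
    using R(1)[OF that(1)] S(1)[OF that(1)] T(1) that(2) comm[OF that(1)]
    by (metis assoc_mult_mat_vec)
  have T0: "T *\<^sub>v 0\<^sub>v n = 0\<^sub>v n"
    using T(1) by (intro eq_vecI) auto
  have preimage: "{v \<in> carrier_vec n. T *\<^sub>v v \<in> W} = {0\<^sub>v n} \<or> {v \<in> carrier_vec n. T *\<^sub>v v \<in> W} = carrier_vec n"
    if W: "VectorSpace.subspace class_ring W (module_vec TYPE(complex) n)"
      and Winv: "\<And>x w. x \<in> carrier X \<Longrightarrow> w \<in> W \<Longrightarrow> \<rho> x *\<^sub>v w \<in> W" for W
  proof (rule inv)
    show "VectorSpace.subspace class_ring {v \<in> carrier_vec n. T *\<^sub>v v \<in> W} (module_vec TYPE(complex) n)"
      using W T(1) T0 unfolding subspace_vec_iff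
      by (auto simp: mult_add_distrib_mat_vec mult_mat_vec)
  next
    fix x w assume x: "x \<in> carrier X" and w: "w \<in> {v \<in> carrier_vec n. T *\<^sub>v v \<in> W}"
    then show "\<sigma> x *\<^sub>v w \<in> {v \<in> carrier_vec n. T *\<^sub>v v \<in> W}"
      using commv[OF x, of w] Winv[OF x] S(1)[OF x] by simp
  qed
  have "{v \<in> carrier_vec n. T *\<^sub>v v \<in> {0\<^sub>v n}} \<noteq> carrier_vec n"
  proof
    assume all: "{v \<in> carrier_vec n. T *\<^sub>v v \<in> {0\<^sub>v n}} = carrier_vec n"
    have "T = 0\<^sub>m n n"
    proof (rule eq_matI)
      fix i j assume "i < dim_row (0\<^sub>m n n :: complex mat)" "j < dim_col (0\<^sub>m n n :: complex mat)"
      then have ij: "i < n" "j < n" by auto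
      have "unit_vec n j \<in> {v \<in> carrier_vec n. T *\<^sub>v v \<in> {0\<^sub>v n}}"
        unfolding all by simp
      then have "(T *\<^sub>v unit_vec n j) $ i = 0\<^sub>v n $ i"
        by simp
      then show "T $$ (i, j) = 0\<^sub>m n n $$ (i, j)"
        using T ij by (auto simp: scalar_prod_right_unit)
    qed (use T in auto)
    then show False
      using T(2) by simp
  qed
  moreover have "VectorSpace.subspace class_ring {0\<^sub>v n} (module_vec TYPE(complex) n)"
    unfolding subspace_vec_iff by auto
  moreover have "\<rho> x *\<^sub>v w \<in> {0\<^sub>v n}" if "x \<in> carrier X" "w \<in> {0\<^sub>v n}" for x w
    using that R(1)[OF that(1)] by auto
  ultimately have "{v \<in> carrier_vec n. T *\<^sub>v v \<in> {0\<^sub>v n}} = {0\<^sub>v n}"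
    using preimage[of "{0\<^sub>v n}"] by blast
  then have "det T \<noteq> 0"
    using det_0_iff_vec_prod_zero[OF T(1)] by blast
  then have "T \<in> Units (ring_mat TYPE(complex) n ())"
    by (rule det_non_zero_imp_unit[OF T(1)])
  then obtain B where B: "B \<in> carrier_mat n n" "T * B = 1\<^sub>m n"
    by (auto simp: Units_def ring_mat_simps)
  have TB: "T *\<^sub>v (B *\<^sub>v w) = w" if "w \<in> carrier_vec n" for w
    using that B T(1) by (simp flip: assoc_mult_mat_vec)
  have "W = {0\<^sub>v n} \<or> W = carrier_vec n"
    if W: "VectorSpace.subspace class_ring W (module_vec TYPE(complex) n)"
      and Winv: "\<And>x w. x \<in> carrier X \<Longrightarrow> w \<in> W \<Longrightarrow> \<rho> x *\<^sub>v w \<in> W" for W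
  proof -
    have sub: "W \<subseteq> carrier_vec n" "0\<^sub>v n \<in> W"
      using W by (auto simp: subspace_vec_iff)
    have pre: "B *\<^sub>v w \<in> {v \<in> carrier_vec n. T *\<^sub>v v \<in> W}" if "w \<in> W" for w
      using TB[of w] that sub(1) B(1) by auto
    from preimage[OF W Winv] show ?thesis
    proof
      assume "{v \<in> carrier_vec n. T *\<^sub>v v \<in> W} = {0\<^sub>v n}"
      then have "B *\<^sub>v w = 0\<^sub>v n" if "w \<in> W" for w
        using pre[OF that] by blast
      then have "w = 0\<^sub>v n" if "w \<in> W" for w
        using TB[of w] that sub(1) T0 by auto
      then show ?thesis
        using sub(2) by blast
    next
      assume all: "{v \<in> carrier_vec n. T *\<^sub>v v \<in> W} = carrier_vec n"
      have "w \<in> W" if "w \<in> carrier_vec n" for w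
      proof -
        have "B *\<^sub>v w \<in> carrier_vec n"
          using B(1) that by simp
        then have "T *\<^sub>v (B *\<^sub>v w) \<in> W"
          using all by blast
        then show ?thesis
          using TB[OF that] by simp
      qed
      then show ?thesis
        using sub(1) by blast
    qed
  qed
  then show ?thesis
    using \<rho> \<open>n > 0\<close> by (simp add: irreducible_representation_def)
qed

lemma mat_trace_one: "mat_trace (1\<^sub>m n) = of_nat n"
  by (simp add: mat_trace_def)

text \<open>
  If all averaged matrix units between \<open>\<rho>\<close> and \<open>\<sigma>\<close> vanished, so would the sum of
  \<open>\<chi>(g) \<chi>(g\<^sup>-\<^sup>1)\<close> over the group, contrary to \<open>irreducible_trace_sum\<close>.
\<close>

lemma irreducible_by_character:
  assumes X: "group X" and fin: "finite (carrier X)"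
    and \<rho>: "representation X n \<rho>" and irr: "irreducible_representation X n' \<sigma>"
    and eq: "afforded_character X \<rho> = afforded_character X \<sigma>"
  shows "irreducible_representation X n \<rho>"
proof -
  interpret group X by fact
  have \<sigma>: "representation X n' \<sigma>"
    using irr by (simp add: irreducible_representation_def)
  have tr: "mat_trace (\<rho> x) = mat_trace (\<sigma> x)" if "x \<in> carrier X" for x
    using fun_cong[OF eq, of x] that by (simp add: afforded_character_def)
  have "n' = n"
    using tr[OF one_closed] representationD(3)[OF X \<rho>] representationD(3)[OF X \<sigma>]
    by (simp add: mat_trace_one)
  then have irr': "irreducible_representation X n \<sigma>" and \<sigma>': "representation X n \<sigma>"
    using irr \<sigma> by auto
  have "(\<Sum>k<n. \<Sum>l<n. averaged_unit X n \<rho> \<sigma> k l $$ (k, l)) \<noteq> 0"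
    using irreducible_trace_sum[OF X fin irr'] sum_trace_trace[OF X \<rho> \<sigma>'] tr by simp
  then obtain k l where kl: "k < n" "l < n" "averaged_unit X n \<rho> \<sigma> k l $$ (k, l) \<noteq> 0"
    by (meson lessThan_iff sum.neutral)
  then have "averaged_unit X n \<rho> \<sigma> k l \<noteq> 0\<^sub>m n n"
    by auto
  then show ?thesis
    using irreducible_equivalent[OF X \<rho> irr' averaged_unit_carrier]
      averaged_unit_intertwines[OF X \<rho> \<sigma>' _ kl(1,2)] by blast
qed

lemma IrrE:
  assumes "\<psi> \<in> Irr X"
  obtains n \<rho> where "irreducible_representation X n \<rho>" "\<psi> = afforded_character X \<rho>"
  using assms by (auto simp: Irr_def)

lemma restrict_afforded_character:
  "K \<subseteq> carrier X \<Longrightarrow>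
   restrict (afforded_character X \<rho>) K = afforded_character (X\<lparr>carrier := K\<rparr>) \<rho>"
  by (auto simp: afforded_character_def restrict_def fun_eq_iff)

text \<open>
  Membership of the restriction in \<^const>\<open>Irr\<close> only says that some irreducible representation of
  \<open>K\<close> has this character. By \<open>irreducible_by_character\<close> the representation affording \<open>\<psi>\<close> is itself
  irreducible on \<open>K\<close>, and a subspace invariant under \<open>L\<close> is invariant under \<open>K\<close>.
\<close>

lemma Irr_restrict_intermediate:
  assumes X: "group X" and fin: "finite (carrier X)"
    and K: "subgroup K X" and L: "subgroup L X" "K \<subseteq> L"
    and \<psi>: "\<psi> \<in> Irr X" "restrict \<psi> K \<in> Irr (X\<lparr>carrier := K\<rparr>)"
  shows "restrict \<psi> L \<in> Irr (X\<lparr>carrier := L\<rparr>)"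
proof -
  note sub = subgroup.subset[OF K] subgroup.subset[OF L(1)]
  obtain n \<rho> where \<rho>: "irreducible_representation X n \<rho>" "\<psi> = afforded_character X \<rho>"
    using IrrE[OF \<psi>(1)] .
  obtain n' \<sigma> where \<sigma>: "irreducible_representation (X\<lparr>carrier := K\<rparr>) n' \<sigma>"
      "restrict \<psi> K = afforded_character (X\<lparr>carrier := K\<rparr>) \<sigma>"
    using IrrE[OF \<psi>(2)] .
  have rep: "representation X n \<rho>"
    using \<rho>(1) by (simp add: irreducible_representation_def)
  have "irreducible_representation (X\<lparr>carrier := K\<rparr>) n \<rho>"
    by (rule irreducible_by_character[OF _ _ _ \<sigma>(1)])
      (use \<sigma>(2) \<rho>(2) sub(1) fin representation_subgroup[OF rep sub(1)]
        group.subgroup_imp_group[OF X K] in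
        \<open>auto simp: restrict_afforded_character finite_subset\<close>)
  then have "irreducible_representation (X\<lparr>carrier := L\<rparr>) n \<rho>"
    using L(2) representation_subgroup[OF rep sub(2)]
    by (auto simp: irreducible_representation_def subset_iff)
  then show ?thesis
    using \<rho>(2) sub(2) by (auto simp: restrict_afforded_character Irr_def)
qed

lemma Irr_one_nonzero:
  assumes "group X" "\<psi> \<in> Irr X"
  shows "\<psi> \<one>\<^bsub>X\<^esub> \<noteq> 0"
proof -
  obtain n \<rho> where "irreducible_representation X n \<rho>" "\<psi> = afforded_character X \<rho>"
    using IrrE[OF assms(2)] .
  then show ?thesis
    using representationD(3)[OF assms(1), of n \<rho>] group.is_monoid[OF assms(1)]
    by (auto simp: irreducible_representation_def afforded_character_def mat_trace_one
        intro: monoid.one_closed)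
qed

text \<open>
  The inner product of \<open>\<theta>\<close> with itself is a sum of squares, one of which is \<open>\<bar>\<theta>(1)\<bar>\<^sup>2 > 0\<close>.
\<close>

lemma lies_over_restrict_Irr:
  assumes "group (G\<lparr>carrier := N\<rparr>)" "finite N"
    and "restrict \<psi> N = \<theta>" "\<theta> \<in> Irr (G\<lparr>carrier := N\<rparr>)"
  shows "lies_over N \<psi> \<theta>"
proof -
  have one: "\<one>\<^bsub>G\<^esub> \<in> N" "\<theta> \<one>\<^bsub>G\<^esub> \<noteq> 0"
    using Irr_one_nonzero[OF assms(1,4)] group.is_monoid[OF assms(1)] monoid.one_closed
    by fastforce+
  have "(\<Sum>x\<in>N. \<theta> x * cnj (\<theta> x)) = of_real (\<Sum>x\<in>N. (cmod (\<theta> x))\<^sup>2)"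
    by (simp only: of_real_sum complex_norm_square)
  moreover have "0 < (\<Sum>x\<in>N. (cmod (\<theta> x))\<^sup>2)"
    using one by (intro sum_pos2[OF assms(2)]) auto
  ultimately have "(\<Sum>x\<in>N. \<theta> x * cnj (\<theta> x)) \<noteq> 0"
    by (simp del: of_real_sum)
  then show ?thesis
    using assms(2) one(1) by (auto simp: lies_over_def char_inner_def assms(3))
qed

lemma trivial_character_Irr_one:
  assumes "group G"
  shows "trivial_character {\<one>\<^bsub>G\<^esub>} \<in> Irr (G\<lparr>carrier := {\<one>\<^bsub>G\<^esub>}\<rparr>)"
proof -
  interpret group G by fact
  let ?\<rho> = "\<lambda>_. 1\<^sub>m 1 :: complex mat"
  have "representation (G\<lparr>carrier := {\<one>\<^bsub>G\<^esub>}\<rparr>) 1 ?\<rho>"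
    by (auto simp: representation_def hom_def units_of_def Units_def ring_mat_simps)
  moreover have "W = {0\<^sub>v 1} \<or> W = carrier_vec 1"
    if "VectorSpace.subspace class_ring W (module_vec TYPE(complex) 1)" for W
  proof (cases "W = {0\<^sub>v 1}")
    case False
    have W: "W \<subseteq> carrier_vec 1" "0\<^sub>v 1 \<in> W" and smult: "\<And>c v. v \<in> W \<Longrightarrow> c \<cdot>\<^sub>v v \<in> W"
      using that by (auto simp: subspace_vec_iff)
    then obtain w where w: "w \<in> W" "w \<noteq> 0\<^sub>v 1"
      using False by auto
    have dw: "dim_vec w = 1"
      using w W by auto
    then have w0: "w $ 0 \<noteq> 0"
      using w(2) by (auto simp: vec_eq_iff)
    have "v \<in> W" if "v \<in> carrier_vec 1" for v
    proof -
      have "v = (v $ 0 / w $ 0) \<cdot>\<^sub>v w"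
        using that dw w0 by (auto simp: vec_eq_iff)
      then show ?thesis
        using smult[OF w(1)] by metis
    qed
    then show ?thesis
      using W by blast
  qed auto
  ultimately have "irreducible_representation (G\<lparr>carrier := {\<one>\<^bsub>G\<^esub>}\<rparr>) 1 ?\<rho>"
    by (auto simp: irreducible_representation_def)
  moreover have "trivial_character {\<one>\<^bsub>G\<^esub>} = afforded_character (G\<lparr>carrier := {\<one>\<^bsub>G\<^esub>}\<rparr>) ?\<rho>"
    by (simp add: trivial_character_def afforded_character_def mat_trace_one)
  ultimately show ?thesis
    by (auto simp: Irr_def)
qed

section \<open>Quotients in a formation\<close>

lemma in_group_class_iso:
  assumes "in_group_class X F" "group X" "X \<cong> Y"
  shows "in_group_class Y F"
proof -
  obtain Z where Z: "Z \<in> F" "X \<cong> Z"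
    using assms(1) by (auto simp: in_group_class_def)
  have "Y \<cong> X"
    using group.iso_sym[OF assms(2,3)] .
  then show ?thesis
    using Z iso_trans unfolding in_group_class_def by blast
qed

lemma in_group_class_iso_iff:
  assumes "group X" "group Y" "X \<cong> Y"
  shows "in_group_class X F \<longleftrightarrow> in_group_class Y F"
  using in_group_class_iso assms group.iso_sym by metis

text \<open>Transfers the closure properties of a formation, stated over \<^typ>\<open>nat\<close>, to groups over any type.\<close>

lemma finite_group_nat_copy:
  assumes "group X" "finite (carrier X)"
  obtains Z :: "nat monoid" and h where "group Z" "finite (carrier Z)" "h \<in> iso X Z"
proof -
  interpret group X by fact
  obtain h :: "'a \<Rightarrow> nat" where inj: "inj_on h (carrier X)"
    using finite_imp_inj_to_nat_seg[OF assms(2)] by blast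
  define M :: "nat monoid" where
    "M = \<lparr>carrier = UNIV,
          monoid.mult = (\<lambda>a b. h (inv_into (carrier X) h a \<otimes>\<^bsub>X\<^esub> inv_into (carrier X) h b)),
          one = 0\<rparr>"
  have hom: "h \<in> hom X M"
    using inj by (auto simp: hom_def M_def)
  define Z where "Z = M\<lparr>carrier := h ` carrier X, one := h \<one>\<^bsub>X\<^esub>\<rparr>"
  have "group Z"
    unfolding Z_def by (rule hom_imp_img_group[OF hom])
  moreover have "h \<in> iso X Z"
    using hom inj by (auto simp: Z_def iso_def hom_def bij_betw_def)
  ultimately show thesis
    using that assms(2) by (simp add: Z_def)
qed

lemma vimage_normal:
  assumes "group_hom X Y h" "M \<lhd> Y"
  shows "{x \<in> carrier X. h x \<in> M} \<lhd> X"
proof -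
  interpret group_hom X Y h by fact
  interpret M: normal M Y by fact
  show ?thesis
  proof (rule G.normal_invI)
    show "subgroup {x \<in> carrier X. h x \<in> M} X"
      by (rule G.subgroupI) (use M.m_inv_closed in auto)
  qed (simp add: M.inv_op_closed2)
qed

text \<open>
  The common source of the transfer along isomorphisms and of the third isomorphism theorem:
  \<open>x \<mapsto> M h(x)\<close> is onto \<open>Y/M\<close>, and its kernel is the preimage of \<open>M\<close>.
\<close>

lemma Mod_vimage_iso:
  assumes "group_hom X Y h" "h ` carrier X = carrier Y" "M \<lhd> Y"
  shows "X Mod {x \<in> carrier X. h x \<in> M} \<cong> Y Mod M"
proof -
  interpret group_hom X Y h by fact
  interpret M: normal M Y by fact
  have grp: "group (Y Mod M)"
    by (rule M.factorgroup_is_group)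
  let ?g = "\<lambda>x. M #>\<^bsub>Y\<^esub> h x"
  have "?g \<in> hom X (Y Mod M)"
    using Group.hom_compose[OF homh M.r_coset_hom_Mod] by (simp add: o_def)
  then interpret g: group_hom X "Y Mod M" ?g
    using grp by (simp add: group_hom_def group_hom_axioms_def)
  have "?g ` carrier X = carrier (Y Mod M)"
    by (simp add: carrier_FactGroup image_image flip: assms(2))
  moreover have "kernel X (Y Mod M) ?g = {x \<in> carrier X. h x \<in> M}"
    using M.subgroup_axioms H.coset_join1[OF _ _ M.subgroup_axioms] H.coset_join2[OF _ M.subgroup_axioms]
    by (auto simp: kernel_def M.subset)
  ultimately show ?thesis
    using g.FactGroup_iso by simp
qed

lemma in_group_class_vimage:
  assumes "group_hom X Y h" "h ` carrier X = carrier Y" "M \<lhd> Y"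
  shows "in_group_class (X Mod {x \<in> carrier X. h x \<in> M}) F \<longleftrightarrow> in_group_class (Y Mod M) F"
  using in_group_class_iso_iff[OF _ _ Mod_vimage_iso[OF assms]]
    normal.factorgroup_is_group[OF vimage_normal[OF assms(1,3)]]
    normal.factorgroup_is_group[OF assms(3)] by blast

lemma iso_imp_group_hom:
  assumes "group X" "group Y" "h \<in> iso X Y"
  shows "group_hom X Y h" "h ` carrier X = carrier Y"
  using assms by (auto simp: group_hom_def group_hom_axioms_def iso_def bij_betw_def)

lemma formation_quotient:
  assumes F: "formation F" and X: "group X" "in_group_class X F" and N: "N \<lhd> X"
  shows "in_group_class (X Mod N) F"
proof -
  obtain Z where Z: "Z \<in> F" "X \<cong> Z"
    using X(2) by (auto simp: in_group_class_def)
  have gZ: "group Z"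
    using F Z(1) by (auto simp: formation_def group_class_def)
  obtain h where h: "h \<in> iso Z X"
    using group.iso_sym[OF X(1) Z(2)] by (auto simp: is_iso_def)
  note hom = iso_imp_group_hom[OF gZ X(1) h]
  have "in_group_class (Z Mod {x \<in> carrier Z. h x \<in> N}) F"
    using F Z(1) vimage_normal[OF hom(1) N] by (auto simp: formation_def)
  then show ?thesis
    using in_group_class_vimage[OF hom N] by simp
qed

text \<open>\<open>X/M\<close> is the quotient of \<open>X/N\<close> by the image of \<open>M\<close>, whose preimage in \<open>X\<close> is again \<open>M\<close>.\<close>

lemma formation_quotient_mono:
  assumes F: "formation F" and N: "N \<lhd> X" and M: "M \<lhd> X" and "N \<subseteq> M"
    and "in_group_class (X Mod N) F"
  shows "in_group_class (X Mod M) F"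
proof -
  interpret N: normal N X by fact
  interpret M: normal M X by fact
  let ?h = "\<lambda>x. N #>\<^bsub>X\<^esub> x"
  have grp: "group (X Mod N)"
    by (rule N.factorgroup_is_group)
  interpret h: group_hom X "X Mod N" ?h
    using grp N.r_coset_hom_Mod by (simp add: group_hom_def group_hom_axioms_def)
  have surj: "?h ` carrier X = carrier (X Mod N)"
    by (simp add: carrier_FactGroup)
  have nor: "?h ` M \<lhd> X Mod N"
    using M.surj_hom_normal_subgroup[OF h.group_hom_axioms surj] .
  have "x \<in> M" if x: "x \<in> carrier X" "?h x \<in> ?h ` M" for x
  proof -
    obtain y where y: "y \<in> M" "?h x = ?h y"
      using x(2) by blast
    then have "x \<in> ?h y"
      using N.rcos_self[OF x(1) N.subgroup_axioms] by simp
    then obtain n where "n \<in> N" "x = n \<otimes>\<^bsub>X\<^esub> y"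
      by (auto simp: r_coset_def)
    then show ?thesis
      using y(1) \<open>N \<subseteq> M\<close> M.m_closed by blast
  qed
  then have "{x \<in> carrier X. ?h x \<in> ?h ` M} = M"
    using M.subset by auto
  then show ?thesis
    using in_group_class_vimage[OF h.group_hom_axioms surj nor, of F]
      formation_quotient[OF F grp assms(5) nor] by simp
qed

lemma formation_quotient_Int:
  assumes F: "formation F" and "finite (carrier X)" and N: "N \<lhd> X" and M: "M \<lhd> X"
    and "in_group_class (X Mod N) F" "in_group_class (X Mod M) F"
  shows "in_group_class (X Mod (M \<inter> N)) F"
proof -
  interpret N: normal N X by fact
  have gX: "group X" ..
  obtain Z :: "nat monoid" and k where Z: "group Z" "finite (carrier Z)" "k \<in> iso X Z"
    using finite_group_nat_copy[OF gX assms(2)] by blast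
  obtain h where h: "h \<in> iso Z X"
    using group.iso_sym[OF gX] Z(3) by (auto simp: is_iso_def)
  note hom = iso_imp_group_hom[OF Z(1) gX h]
  let ?v = "\<lambda>N. {x \<in> carrier Z. h x \<in> N}"
  have "in_group_class (Z Mod (?v M \<inter> ?v N)) F"
    using F Z assms(5,6) in_group_class_vimage[OF hom N] in_group_class_vimage[OF hom M]
      vimage_normal[OF hom(1) N] vimage_normal[OF hom(1) M]
    by (auto simp: formation_def)
  moreover have "?v M \<inter> ?v N = ?v (M \<inter> N)"
    by auto
  ultimately show ?thesis
    using in_group_class_vimage[OF hom N.normal_subgroup_intersect[OF M N]] by simp
qed

lemma vimage_maximal_subgroup:
  assumes "group_hom X Y h" "h ` carrier X = carrier Y" "maximal_subgroup M Y"
  shows "maximal_subgroup {x \<in> carrier X. h x \<in> M} X"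
proof -
  interpret group_hom X Y h by fact
  let ?v = "{x \<in> carrier X. h x \<in> M}"
  have M: "subgroup M Y" "M \<noteq> carrier Y"
    and max: "\<And>U. subgroup U Y \<Longrightarrow> M \<subseteq> U \<Longrightarrow> U = M \<or> U = carrier Y"
    using assms(3) by (auto simp: maximal_subgroup_def)
  interpret M: subgroup M Y by fact
  have sub: "subgroup ?v X"
    by (rule G.subgroupI) (use M.m_inv_closed in auto)
  have "M \<subseteq> h ` carrier X"
    using M.subset assms(2) by simp
  moreover have "?v \<noteq> carrier X"
  proof
    assume "?v = carrier X"
    then have "h ` carrier X \<subseteq> M"
      by auto
    then show False
      using M(2) M.subset assms(2) by simp
  qed
  moreover have "U = ?v \<or> U = carrier X" if U: "subgroup U X" "?v \<subseteq> U" for U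
  proof -
    interpret U: subgroup U X by fact
    \<comment> \<open>\<open>U\<close> contains the kernel, hence is a union of fibres of \<open>h\<close>.\<close>
    have sat: "x \<in> U" if x: "x \<in> carrier X" "h x \<in> h ` U" for x
    proof -
      obtain u where u: "u \<in> U" "h x = h u"
        using x(2) by blast
      have "x \<otimes>\<^bsub>X\<^esub> inv\<^bsub>X\<^esub> u \<in> ?v"
        using x u by simp
      then have "x \<otimes>\<^bsub>X\<^esub> inv\<^bsub>X\<^esub> u \<otimes>\<^bsub>X\<^esub> u \<in> U"
        using U(2) u by blast
      then show ?thesis
        using x u by (simp add: G.m_assoc)
    qed
    have "h ` U = M \<or> h ` U = carrier Y"
    proof (rule max)
      show "subgroup (h ` U) Y"
        by (rule subgroup_img_is_subgroup[OF U(1)])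
      show "M \<subseteq> h ` U"
        using \<open>M \<subseteq> h ` carrier X\<close> U(2) by blast
    qed
    then show ?thesis
    proof
      assume "h ` U = M"
      then show ?thesis using U(2) U.subset by auto
    next
      assume "h ` U = carrier Y"
      then show ?thesis using sat U.subset by auto
    qed
  qed
  ultimately show ?thesis
    using sub by (auto simp: maximal_subgroup_def)
qed

text \<open>Conjugation is a surjective homomorphism, so it permutes the maximal subgroups.\<close>

lemma frattini_normal:
  assumes "group X"
  shows "frattini X \<lhd> X"
proof -
  interpret group X by fact
  have sub: "subgroup (frattini X) X"
  proof -
    have "frattini X = \<Inter> (insert (carrier X) {M. maximal_subgroup M X})"
      by (simp add: frattini_def)
    then show ?thesis
      using subgroups_Inter[of "insert (carrier X) {M. maximal_subgroup M X}"] subgroup_self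
      by (auto simp: maximal_subgroup_def)
  qed
  show ?thesis
  proof (rule normal_invI[OF sub])
    fix g x assume g: "g \<in> carrier X" and x: "x \<in> frattini X"
    let ?c = "\<lambda>x. g \<otimes>\<^bsub>X\<^esub> x \<otimes>\<^bsub>X\<^esub> inv\<^bsub>X\<^esub> g"
    have "?c (a \<otimes>\<^bsub>X\<^esub> b) = ?c a \<otimes>\<^bsub>X\<^esub> ?c b" if "a \<in> carrier X" "b \<in> carrier X" for a b
      using g that by (simp add: m_assoc) (simp add: m_assoc[symmetric])
    then have hom: "group_hom X X ?c"
      using g by (simp add: group_hom_def group_hom_axioms_def hom_def)
    have "y \<in> ?c ` carrier X" if "y \<in> carrier X" for y
      by (rule image_eqI[of _ _ "inv\<^bsub>X\<^esub> g \<otimes>\<^bsub>X\<^esub> y \<otimes>\<^bsub>X\<^esub> g"])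
        (use g that in \<open>simp_all add: m_assoc[symmetric]\<close>, simp add: m_assoc)
    then have surj: "?c ` carrier X = carrier X"
      using g by auto
    have "?c x \<in> M" if "maximal_subgroup M X" for M
      using vimage_maximal_subgroup[OF hom surj that] x by (auto simp: frattini_def)
    then show "?c x \<in> frattini X"
      using g x by (auto simp: frattini_def)
  qed
qed

text \<open>
  The form in which saturation is used: the hypothesis on maximal subgroups says that \<open>R/N\<close> lies in
  the Frattini subgroup of \<open>X/N\<close>, so that the Frattini quotient of \<open>X/N\<close> is a quotient of \<open>X/R\<close>.
\<close>

lemma saturated_quotient:
  assumes F: "saturated_formation F" and "group X" "finite (carrier X)"
    and N: "N \<lhd> X" and R: "R \<lhd> X" "N \<subseteq> R" "in_group_class (X Mod R) F"
    and max: "\<And>M. maximal_subgroup M X \<Longrightarrow> N \<subseteq> M \<Longrightarrow> R \<subseteq> M"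
  shows "in_group_class (X Mod N) F"
proof -
  interpret N: normal N X by fact
  interpret R: normal R X by fact
  have form: "formation F"
    using F by (simp add: saturated_formation_def)
  have grp: "group (X Mod N)"
    by (rule N.factorgroup_is_group)
  have fin: "finite (carrier (X Mod N))"
    using assms(3) by (simp add: carrier_FactGroup)
  obtain Z :: "nat monoid" and k where Z: "group Z" "finite (carrier Z)" "k \<in> iso (X Mod N) Z"
    using finite_group_nat_copy[OF grp fin] by blast
  define h where "h x = k (N #>\<^bsub>X\<^esub> x)" for x
  have "h \<in> hom X Z"
    using Group.hom_compose[OF N.r_coset_hom_Mod, of k Z] Z(3) by (simp add: h_def[abs_def] o_def iso_def)
  then interpret h: group_hom X Z h
    using Z(1) by (simp add: group_hom_def group_hom_axioms_def)
  have surj: "h ` carrier X = carrier Z"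
  proof -
    have "h ` carrier X = k ` carrier (X Mod N)"
      by (auto simp: h_def carrier_FactGroup)
    then show ?thesis
      using Z(3) by (simp add: iso_def bij_betw_def)
  qed
  have oneN: "h x = \<one>\<^bsub>Z\<^esub>" if "x \<in> N" for x
    using that hom_one[of k "X Mod N" Z] Z grp N.coset_join2[OF _ N.subgroup_axioms, of x]
    by (simp add: h_def iso_def N.mem_carrier)
  let ?v = "{x \<in> carrier X. h x \<in> frattini Z}"
  have "R \<subseteq> ?v"
  proof
    fix x assume x: "x \<in> R"
    have "h x \<in> M" if M: "maximal_subgroup M Z" for M
    proof -
      have "N \<subseteq> {x \<in> carrier X. h x \<in> M}"
        using oneN N.subset M by (auto simp: maximal_subgroup_def subgroup.one_closed)
      then show ?thesis
        using max[OF vimage_maximal_subgroup[OF h.group_hom_axioms surj M]] x by auto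
    qed
    then show "x \<in> ?v"
      using x R.subset by (auto simp: frattini_def)
  qed
  then have "in_group_class (X Mod ?v) F"
    using formation_quotient_mono[OF form R(1)
        vimage_normal[OF h.group_hom_axioms frattini_normal[OF Z(1)]]] R(3) by simp
  then have "Z \<in> F"
    using in_group_class_vimage[OF h.group_hom_axioms surj frattini_normal[OF Z(1)]] F Z
    by (auto simp: saturated_formation_def)
  then show ?thesis
    using Z(3) by (auto simp: in_group_class_def is_iso_def)
qed

section \<open>Products with normalised subgroups\<close>

context group
begin

text \<open>
  Unlike normality of \<open>N\<close> in \<open>U\<close>, this does not require \<open>N \<subseteq> U\<close>. It passes to subgroups of \<open>U\<close> and
  makes sense for the two factors of a product \<open>U N\<close>.
\<close>

definition normalises :: "'a set \<Rightarrow> 'a set \<Rightarrow> bool" where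
  "normalises U N \<longleftrightarrow> subgroup U G \<and> subgroup N G \<and> (\<forall>u\<in>U. \<forall>n\<in>N. u \<otimes> n \<otimes> inv u \<in> N)"

lemma normal_subgroup_iff_normalises:
  assumes "subgroup V G"
  shows "N \<lhd> G\<lparr>carrier := V\<rparr> \<longleftrightarrow> normalises V N \<and> N \<subseteq> V"
proof -
  interpret V: group "G\<lparr>carrier := V\<rparr>"
    using subgroup_imp_group[OF assms] .
  have "subgroup N (G\<lparr>carrier := V\<rparr>) \<longleftrightarrow> subgroup N G \<and> N \<subseteq> V"
    using incl_subgroup[OF assms] subgroup_incl[of N V] assms subgroup.subset[of N "G\<lparr>carrier := V\<rparr>"]
    by auto
  then show ?thesis
    unfolding V.normal_inv_iff normalises_def
    using assms m_inv_consistent[OF assms] by auto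
qed

lemma normal_iff_normalises: "N \<lhd> G \<longleftrightarrow> normalises (carrier G) N"
  using normal_subgroup_iff_normalises[OF subgroup_self, of N]
  using subgroup.subset[of N G] by (auto simp: normalises_def)

lemma normalises_subgroup:
  "normalises V N \<Longrightarrow> subgroup U G \<Longrightarrow> U \<subseteq> V \<Longrightarrow> normalises U N"
  by (auto simp: normalises_def)

lemma normalises_self: "subgroup U G \<Longrightarrow> normalises U U"
  by (auto simp: normalises_def intro!: subgroup.m_closed subgroup.m_inv_closed)

lemma normalises_one: "subgroup U G \<Longrightarrow> normalises U {\<one>}"
  using normalises_subgroup[OF one_is_normal[unfolded normal_iff_normalises]] subgroup.subset
  by blast

lemma normalises_Int:
  "normalises U M \<Longrightarrow> normalises U N \<Longrightarrow> normalises U (M \<inter> N)"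
  by (auto simp: normalises_def subgroups_Inter_pair)

lemma set_mult_iff: "x \<in> U <#> N \<longleftrightarrow> (\<exists>u\<in>U. \<exists>n\<in>N. x = u \<otimes> n)"
  by (auto simp: set_mult_def)

lemma normalises_set_mult:
  assumes "normalises U N"
  shows "subgroup (U <#> N) G" "U \<subseteq> U <#> N" "N \<subseteq> U <#> N" "N <#> U = U <#> N"
proof -
  interpret U: subgroup U G using assms by (simp add: normalises_def)
  interpret N: subgroup N G using assms by (simp add: normalises_def)
  have conj: "u \<otimes> n \<otimes> inv u \<in> N" if "u \<in> U" "n \<in> N" for u n
    using assms that by (simp add: normalises_def)
  have swap: "\<exists>n'\<in>N. u \<otimes> n = n' \<otimes> u" if "u \<in> U" "n \<in> N" for u n
    using conj[OF that] that by (intro bexI[of _ "u \<otimes> n \<otimes> inv u"]) (simp_all add: m_assoc)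
  have swap': "\<exists>n'\<in>N. n \<otimes> u = u \<otimes> n'" if "u \<in> U" "n \<in> N" for u n
    using conj[of "inv u" n] that
    by (intro bexI[of _ "inv u \<otimes> n \<otimes> u"]) (simp_all add: m_assoc[symmetric])
  show comm: "N <#> U = U <#> N"
    unfolding set_eq_iff set_mult_iff using swap swap' by metis
  show "subgroup (U <#> N) G"
  proof (rule subgroupI)
    show "U <#> N \<subseteq> carrier G"
      by (auto simp: set_mult_iff)
    show "U <#> N \<noteq> {}"
      using U.one_closed N.one_closed by (auto simp: set_mult_def simp del: U.one_closed N.one_closed)
  next
    fix x assume "x \<in> U <#> N"
    then obtain u n where "u \<in> U" "n \<in> N" "x = u \<otimes> n"
      by (auto simp: set_mult_iff)
    then have "inv x \<in> N <#> U"
      by (auto simp: set_mult_iff inv_mult_group)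
    then show "inv x \<in> U <#> N"
      by (simp add: comm)
  next
    fix x y assume "x \<in> U <#> N" "y \<in> U <#> N"
    then obtain u n v k where *: "u \<in> U" "n \<in> N" "x = u \<otimes> n" "v \<in> U" "k \<in> N" "y = v \<otimes> k"
      by (auto simp: set_mult_iff)
    obtain n' where n': "n' \<in> N" "n \<otimes> v = v \<otimes> n'"
      using swap'[OF *(4,2)] by blast
    have "x \<otimes> y = u \<otimes> (n \<otimes> v) \<otimes> k"
      using * by (simp add: m_assoc)
    also have "\<dots> = (u \<otimes> v) \<otimes> (n' \<otimes> k)"
      using * n' by (simp add: m_assoc)
    finally show "x \<otimes> y \<in> U <#> N"
      using * n' U.m_closed N.m_closed unfolding set_mult_iff by blast
  qed
  show "U \<subseteq> U <#> N"
  proof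
    fix u assume "u \<in> U"
    then show "u \<in> U <#> N"
      unfolding set_mult_iff by (intro bexI[of _ u] bexI[of _ \<one>]) auto
  qed
  show "N \<subseteq> U <#> N"
  proof
    fix n assume "n \<in> N"
    then show "n \<in> U <#> N"
      unfolding set_mult_iff by (intro bexI[of _ \<one>] bexI[of _ n]) auto
  qed
qed

lemma set_mult_subset_subgroup:
  "subgroup V G \<Longrightarrow> U \<subseteq> V \<Longrightarrow> N \<subseteq> V \<Longrightarrow> U <#> N \<subseteq> V"
  by (auto simp: set_mult_iff subset_iff intro: subgroup.m_closed)

lemma set_mult_normalises:
  assumes "normalises U N" "normalises U M" "normalises N M"
  shows "normalises (U <#> N) M"
proof -
  have "x \<otimes> m \<otimes> inv x \<in> M" if x: "x \<in> U <#> N" and m: "m \<in> M" for x m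
  proof -
    obtain u n where un: "u \<in> U" "n \<in> N" "x = u \<otimes> n"
      using x by (auto simp: set_mult_iff)
    have "u \<otimes> (n \<otimes> m \<otimes> inv n) \<otimes> inv u \<in> M"
      using assms(2,3) un m by (auto simp: normalises_def)
    moreover have "u \<in> carrier G" "n \<in> carrier G" "m \<in> carrier G"
      using assms un m by (auto simp: normalises_def dest: subgroup.mem_carrier)
    ultimately show ?thesis
      using un(3) by (simp add: m_assoc inv_mult_group)
  qed
  then show ?thesis
    using normalises_set_mult(1)[OF assms(1)] assms(2) by (simp add: normalises_def)
qed

lemma second_isomorphism_class:
  assumes "normalises U N"
  shows "in_group_class (G\<lparr>carrier := U <#> N\<rparr> Mod N) F \<longleftrightarrow>
         in_group_class (G\<lparr>carrier := U\<rparr> Mod (U \<inter> N)) F"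
proof -
  let ?P = "G\<lparr>carrier := U <#> N\<rparr>"
  note P = normalises_set_mult[OF assms]
  have U: "subgroup U G" and N: "subgroup N G"
    using assms by (auto simp: normalises_def)
  interpret P: group ?P
    using subgroup_imp_group[OF P(1)] .
  have nor: "N \<lhd> ?P"
    using set_mult_normalises[OF assms assms normalises_self[OF N]] P
    by (simp add: normal_subgroup_iff_normalises)
  have norU: "U \<inter> N \<lhd> G\<lparr>carrier := U\<rparr>"
    using normalises_Int[OF normalises_self[OF U] assms] U
    by (simp add: normal_subgroup_iff_normalises)
  have "subgroup U ?P"
    using subgroup_incl[OF U P(1,2)] .
  from P.weak_snd_iso_thme[OF this nor]
  have "?P Mod N \<cong> G\<lparr>carrier := U\<rparr> Mod (U \<inter> N)"
    by (simp add: P(4) Int_commute)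
  then show ?thesis
    using in_group_class_iso_iff normal.factorgroup_is_group[OF nor]
      normal.factorgroup_is_group[OF norU] by blast
qed

end

section \<open>Projectors of subgroups of a solvable group\<close>

locale formation_group = group G for G :: "('a, 'b) monoid_scheme" (structure) +
  fixes F :: "nat monoid set"
  assumes finite_carrier: "finite (carrier G)"
    and saturated: "saturated_formation F"
begin

abbreviation quotient_in :: "'a set \<Rightarrow> 'a set \<Rightarrow> bool" where
  "quotient_in V N \<equiv> in_group_class (G\<lparr>carrier := V\<rparr> Mod N) F"

lemma formation: "formation F"
  using saturated by (simp add: saturated_formation_def)

lemma finite_subgroup: "subgroup U G \<Longrightarrow> finite U"
  using finite_subset[OF subgroup.subset finite_carrier] .

lemma quotient_in_mono:
  assumes "normalises V N" "normalises V M" "N \<subseteq> M" "M \<subseteq> V" "quotient_in V N"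
  shows "quotient_in V M"
  using assms formation_quotient_mono[OF formation, of N "G\<lparr>carrier := V\<rparr>" M]
  by (auto simp: normal_subgroup_iff_normalises normalises_def)

lemma quotient_in_Int:
  assumes "normalises V N" "normalises V M" "N \<subseteq> V" "M \<subseteq> V" "quotient_in V N" "quotient_in V M"
  shows "quotient_in V (N \<inter> M)"
  using assms formation_quotient_Int[OF formation, of "G\<lparr>carrier := V\<rparr>" M N] finite_subgroup[of V]
  by (auto simp: normal_subgroup_iff_normalises normalises_def)

lemma quotient_in_second_iso:
  "normalises U N \<Longrightarrow> quotient_in (U <#> N) N \<longleftrightarrow> quotient_in U (U \<inter> N)"
  by (rule second_isomorphism_class)

lemma obtain_minimal_subgroup:
  assumes "P U" and sub: "\<And>U. P U \<Longrightarrow> subgroup U G"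
  obtains K where "P K" "\<And>U. P U \<Longrightarrow> U \<subseteq> K \<Longrightarrow> U = K"
proof -
  obtain K where K: "P K" "\<And>U. P U \<Longrightarrow> card K \<le> card U"
    using ex_has_least_nat[of P U card] assms(1) by blast
  moreover have "U = K" if "P U" "U \<subseteq> K" for U
    using card_seteq[OF finite_subgroup[OF sub[OF K(1)]] that(2) K(2)[OF that(1)]] .
  ultimately show thesis
    using that by blast
qed

text \<open>
  Let \<open>B/Z\<close> be abelian and normal in \<open>Y/Z = (H/Z)(B/Z)\<close>, and let \<open>H/Z\<close> be maximal among the subgroups of
  \<open>Y/Z\<close> in the formation. Then \<open>H\<close> covers every quotient \<open>Y/B\<^sub>0\<close> in the formation with \<open>B\<^sub>0 \<subseteq> B\<close>.

  Among the supplements of \<open>B\<^sub>0\<close> containing \<open>H\<close> take a minimal one \<open>K\<close>. If \<open>K/Z\<close> is in the formation,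
  then \<open>K = H\<close>. Otherwise let \<open>R\<close> with \<open>Z \<subseteq> R \<subseteq> K \<inter> B\<^sub>0\<close> be minimal with \<open>K/R\<close> in the formation. By saturation some
  maximal subgroup \<open>M\<close> of \<open>K\<close> contains \<open>Z\<close> but not \<open>R\<close>. Since \<open>B/Z\<close> is abelian, \<open>C = K \<inter> B \<inter> M\<close> is
  normalised by \<open>R\<close> and \<open>M\<close>, hence normal in \<open>K = M R\<close>, and \<open>K = H C R\<close>. So \<open>H C\<close> is a supplement as
  well, and \<open>K = H C\<close> by minimality. But then \<open>K/C\<close>, a quotient of \<open>H/Z\<close>, is in the formation, which
  forces \<open>R \<subseteq> C \<subseteq> M\<close>.
\<close>

lemma maximal_in_class_supplements:
  assumes Y: "subgroup Y G" and H: "subgroup H G"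
    and B: "normalises Y B" and Z: "normalises Y Z"
    and B0: "normalises Y B\<^sub>0" "Z \<subseteq> B\<^sub>0" "B\<^sub>0 \<subseteq> B"
    and comm: "\<And>x y. x \<in> B \<Longrightarrow> y \<in> B \<Longrightarrow> x \<otimes> y \<otimes> inv x \<otimes> inv y \<in> Z"
    and HB: "Z \<subseteq> H" "H <#> B = Y"
    and YB0: "quotient_in Y B\<^sub>0" and HZ: "quotient_in H Z"
    and max: "\<And>U. subgroup U G \<Longrightarrow> H \<subseteq> U \<Longrightarrow> U \<subseteq> Y \<Longrightarrow> quotient_in U Z \<Longrightarrow> U = H"
  shows "H <#> B\<^sub>0 = Y"
proof -
  have norHB: "normalises H B"
    using B H HB(2) by (metis normalises_def normalises_set_mult(2) normalises_subgroup
      subgroup.one_closed subgroup.subset subsetI set_mult_iff r_one subgroup.mem_carrier)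
  have HY: "H \<subseteq> Y" and BY: "B \<subseteq> Y"
    using normalises_set_mult(2,3)[OF norHB] HB(2) by auto
  define S where "S K \<longleftrightarrow> subgroup K G \<and> H \<subseteq> K \<and> K \<subseteq> Y \<and> K <#> B\<^sub>0 = Y" for K
  have "S Y"
    using Y HY normalises_set_mult(2)[OF B0(1)] set_mult_subset_subgroup[OF Y, of Y B\<^sub>0] B0(3) BY
    by (auto simp: S_def)
  then obtain K where "S K" and Kmin: "\<And>U. S U \<Longrightarrow> U \<subseteq> K \<Longrightarrow> U = K"
    using obtain_minimal_subgroup[of S Y] by (auto simp: S_def)
  then have K: "subgroup K G" "H \<subseteq> K" "K \<subseteq> Y" "K <#> B\<^sub>0 = Y"
    by (auto simp: S_def)
  interpret K: subgroup K G by fact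
  have norK: "normalises K X" if "normalises Y X" for X
    using normalises_subgroup[OF that K(1,3)] .
  have "quotient_in K Z"
  proof (rule ccontr)
    assume notZ: "\<not> quotient_in K Z"
    define T where "T R \<longleftrightarrow> normalises K R \<and> Z \<subseteq> R \<and> R \<subseteq> K \<inter> B\<^sub>0 \<and> quotient_in K R" for R
    have "T (K \<inter> B\<^sub>0)"
      using normalises_Int[OF normalises_self[OF K(1)] norK[OF B0(1)]] HB(1) K B0 YB0
        quotient_in_second_iso[OF norK[OF B0(1)]]
      by (auto simp: T_def)
    then obtain R where "T R" and Rmin: "\<And>U. T U \<Longrightarrow> U \<subseteq> R \<Longrightarrow> U = R"
      using obtain_minimal_subgroup[of T "K \<inter> B\<^sub>0"] by (auto simp: T_def normalises_def)
    then have R: "normalises K R" "Z \<subseteq> R" "R \<subseteq> K" "R \<subseteq> B\<^sub>0" "quotient_in K R"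
      by (auto simp: T_def)
    have sR: "subgroup R G"
      using R(1) by (simp add: normalises_def)
    have ZK: "Z \<subseteq> K"
      using HB(1) K(2) by blast
    obtain M where M: "maximal_subgroup M (G\<lparr>carrier := K\<rparr>)" "Z \<subseteq> M" "\<not> R \<subseteq> M"
      using saturated_quotient[OF saturated subgroup_imp_group[OF K(1)], of Z R]
        notZ R norK[OF Z] ZK finite_subgroup[OF K(1)]
      by (auto simp: normal_subgroup_iff_normalises[OF K(1)])
    have sM: "subgroup M G" "M \<subseteq> K"
      using M(1) incl_subgroup[OF K(1)] subgroup.subset[of M "G\<lparr>carrier := K\<rparr>"]
      by (auto simp: maximal_subgroup_def)
    have norMR: "normalises M R"
      using normalises_subgroup[OF R(1) sM] .
    note MR = normalises_set_mult[OF norMR]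
    have MRK: "M <#> R \<subseteq> K"
      using set_mult_subset_subgroup[OF K(1) sM(2) R(3)] .
    have "M <#> R = M \<or> M <#> R = K"
      using M(1) subgroup_incl[OF MR(1) K(1) MRK] MR(2) by (auto simp: maximal_subgroup_def)
    then have MReq: "M <#> R = K"
      using MR(3) M(3) by auto
    define C where "C = K \<inter> B \<inter> M"
    have ZC: "Z \<subseteq> C"
      using ZK M(2) B0 by (auto simp: C_def)
    have "normalises M C"
      unfolding C_def using normalises_Int normalises_self normalises_subgroup[OF norK[OF B] sM]
        normalises_subgroup[OF normalises_self[OF K(1)] sM] sM by metis
    moreover have "normalises R C"
    proof -
      have sC: "subgroup C G"
        using \<open>normalises M C\<close> by (simp add: normalises_def)
      interpret C: subgroup C G by fact
      have "r \<otimes> c \<otimes> inv r \<in> C" if "r \<in> R" "c \<in> C" for r c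
      proof -
        have "r \<otimes> c \<otimes> inv r \<otimes> inv c \<in> Z"
          using comm[of r c] that R(4) B0(3) by (auto simp: C_def)
        then have "r \<otimes> c \<otimes> inv r \<otimes> inv c \<otimes> c \<in> C"
          using ZC that(2) by blast
        moreover have "r \<in> carrier G"
          using that(1) sR by (rule subgroup.mem_carrier[rotated])
        ultimately show ?thesis
          using that(2) by (simp add: m_assoc)
      qed
      then show ?thesis
        using sC sR by (simp add: normalises_def)
    qed
    ultimately have norKC: "normalises K C"
      using set_mult_normalises[OF norMR] MReq by simp
    have CK: "C \<subseteq> K"
      by (auto simp: C_def)
    have norHC: "normalises H C"
      using normalises_subgroup[OF norKC H K(2)] .
    \<comment> \<open>Dedekind's law twice: \<open>K = H (K \<inter> B)\<close> and \<open>K \<inter> B = C R\<close>.\<close>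
    have KHCR: "\<exists>h\<in>H. \<exists>c\<in>C. \<exists>r\<in>R. k = h \<otimes> c \<otimes> r" if k: "k \<in> K" for k
    proof -
      obtain h b where hb: "h \<in> H" "b \<in> B" "k = h \<otimes> b"
        using k K(3) set_mult_iff[of k H B] HB(2) by blast
      have carr: "h \<in> carrier G" "b \<in> carrier G"
        using hb K(2) K.subset BY subgroup.subset[OF Y] by auto
      have "b = inv h \<otimes> k"
        using hb carr by (simp add: m_assoc[symmetric])
      then have bK: "b \<in> K"
        using hb(1) k K(2) by auto
      then obtain m r where mr: "m \<in> M" "r \<in> R" "b = m \<otimes> r"
        using MReq by (auto simp: set_mult_iff)
      have carr': "m \<in> carrier G" "r \<in> carrier G"
        using mr sM R(3) K.subset by auto
      have rB: "r \<in> B"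
        using mr(2) R(4) B0(3) by auto
      have sB: "subgroup B G"
        using B by (simp add: normalises_def)
      have "m = b \<otimes> inv r"
        using mr carr' by (simp add: m_assoc)
      then have "m \<in> C"
        using mr sM(2) subgroup.m_closed[OF sB hb(2) subgroup.m_inv_closed[OF sB rB]]
        by (auto simp: C_def)
      moreover have "k = h \<otimes> m \<otimes> r"
        using hb(3) mr(3) carr carr' by (simp add: m_assoc)
      ultimately show ?thesis
        using hb(1) mr(2) by blast
    qed
    have HCK: "H <#> C \<subseteq> K"
      using set_mult_subset_subgroup[OF K(1,2) CK] .
    note HC = normalises_set_mult[OF norHC]
    have "H <#> C <#> B\<^sub>0 = Y"
    proof
      show "H <#> C <#> B\<^sub>0 \<subseteq> Y"
        using set_mult_subset_subgroup[OF Y, of "H <#> C" B\<^sub>0] HCK K(3) B0(3) BY by blast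
      show "Y \<subseteq> H <#> C <#> B\<^sub>0"
      proof
        fix y assume "y \<in> Y"
        then obtain k b where kb: "k \<in> K" "b \<in> B\<^sub>0" "y = k \<otimes> b"
          using K(4) by (auto simp: set_mult_iff)
        obtain h c r where hcr: "h \<in> H" "c \<in> C" "r \<in> R" "k = h \<otimes> c \<otimes> r"
          using KHCR[OF kb(1)] by blast
        have carr: "h \<in> carrier G" "c \<in> carrier G" "r \<in> carrier G" "b \<in> carrier G"
          using hcr kb K(2) CK R(3) K.subset B0(3) BY subgroup.subset[OF Y] by auto
        have "r \<otimes> b \<in> B\<^sub>0"
          using hcr(3) R(4) kb(2) B0(1) by (auto simp: normalises_def intro: subgroup.m_closed)
        moreover have "h \<otimes> c \<in> H <#> C"
          using hcr by (auto simp: set_mult_iff)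
        moreover have "y = (h \<otimes> c) \<otimes> (r \<otimes> b)"
          using hcr(4) kb(3) carr by (simp add: m_assoc)
        ultimately show "y \<in> H <#> C <#> B\<^sub>0"
          unfolding set_mult_iff[of y] by blast
      qed
    qed
    then have HCeq: "H <#> C = K"
      using Kmin[OF _ HCK] HC HCK K(3) by (auto simp: S_def)
    have "quotient_in H (H \<inter> C)"
      using quotient_in_mono[of H Z "H \<inter> C"] HZ ZC HB(1) normalises_subgroup[OF Z H HY]
        normalises_Int[OF normalises_self[OF H] norHC] by auto
    then have "quotient_in K C"
      using quotient_in_second_iso[OF norHC] HCeq by simp
    then have "quotient_in K (R \<inter> C)"
      using quotient_in_Int[OF R(1) norKC R(3) CK R(5)] by simp
    then have "T (R \<inter> C)"
      using normalises_Int[OF R(1) norKC] R ZC by (auto simp: T_def)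
    then have "R \<inter> C = R"
      using Rmin by blast
    then show False
      using M(3) by (auto simp: C_def)
  qed
  then have "K = H"
    using max K by blast
  then show ?thesis
    using K(4) by simp
qed

text \<open>
  Projectors of a solvable group are covering subgroups. The induction runs along the derived
  series \<open>A\<^sub>j\<close>, proving the claim for all \<open>N \<supseteq> A\<^sub>j\<close>. Working inside \<open>G\<close> and relative to \<open>A\<^sub>j\<close>,
  instead of in \<open>G/A\<^sub>j\<close>, keeps all groups over the same type.
\<close>

lemma projector_in_subgroup:
  assumes proj: "projector F G H" and "solvable G"
    and V: "subgroup V G" "H \<subseteq> V" and N: "normalises V N" "N \<subseteq> V" and VN: "quotient_in V N"
  shows "H <#> N = V"
proof -
  have H: "subgroup H G"
    and projF: "\<And>N. N \<lhd> G \<Longrightarrow> quotient_in (H <#> N) N"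
    and projmax: "\<And>N V. N \<lhd> G \<Longrightarrow> subgroup V G \<Longrightarrow> H <#> N \<subseteq> V \<Longrightarrow> quotient_in V N \<Longrightarrow> H <#> N = V"
    using proj by (auto simp: projector_def)
  interpret H: subgroup H G by fact
  define A where "A j = (derived G ^^ j) (carrier G)" for j
  have Anor: "A j \<lhd> G" for j
    unfolding A_def by (induction j) (auto intro: derived_is_normal normal_self)
  have norA: "normalises U (A j)" if "subgroup U G" for U j
    using normalises_subgroup[OF _ that subgroup.subset[OF that]] Anor
    by (auto simp: normal_iff_normalises)
  have HF: "quotient_in H {\<one>}"
    using projF[OF one_is_normal] by (simp add: set_mult_def H.subset) 
  have step: "\<forall>V N. subgroup V G \<and> H \<subseteq> V \<and> normalises V N \<and> N \<subseteq> V \<and> A j \<subseteq> N \<and> quotient_in V N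
          \<longrightarrow> H <#> N = V" for j
  proof (induction j)
    case 0
    show ?case
    proof clarify
      fix V N assume V: "subgroup V G" and "normalises V N" "H \<subseteq> V" "N \<subseteq> V" "A 0 \<subseteq> N"
      then have "normalises H N"
        using normalises_subgroup H by blast
      then have "N \<subseteq> H <#> N" "H <#> N \<subseteq> carrier G"
        using normalises_set_mult(1,3)[of H N] subgroup.subset[of "H <#> N" G] by auto
      then show "H <#> N = V"
        using subgroup.subset[OF V] \<open>N \<subseteq> V\<close> \<open>A 0 \<subseteq> N\<close> by (auto simp: A_def)
    qed
  next
    case (Suc j)
    show ?case
    proof clarify
      fix V N assume V: "subgroup V G" "H \<subseteq> V" and N: "normalises V N" "N \<subseteq> V"
        and ZN: "A (Suc j) \<subseteq> N" and VN: "quotient_in V N"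
      define Z where "Z = A (Suc j)"
      define B where "B = V \<inter> A j"
      interpret V: subgroup V G by fact
      have sN: "subgroup N G"
        using N(1) by (simp add: normalises_def)
      interpret N: subgroup N G by fact
      have norHN: "normalises H N"
        using normalises_subgroup[OF N(1) H V(2)] .
      have HNV: "H <#> N \<subseteq> V"
        using set_mult_subset_subgroup[OF V N(2)] .
      have norB: "normalises V B"
        unfolding B_def using normalises_Int[OF normalises_self[OF V(1)] norA[OF V(1)]] .
      have norZ: "normalises U Z" if "subgroup U G" for U
        unfolding Z_def using norA[OF that] .
      have comm: "x \<otimes> y \<otimes> inv x \<otimes> inv y \<in> Z" if "x \<in> A j" "y \<in> A j" for x y
        using that by (auto simp: Z_def A_def derived_def intro!: generate.incl)
      have ZA: "Z \<subseteq> A j"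
        using derived_incl[of "A j" "A j"] normal_imp_subgroup[OF Anor] by (auto simp: Z_def A_def)
      \<comment> \<open>\<open>V A\<^sub>j / N A\<^sub>j\<close> is a quotient of \<open>V/N\<close>, so the induction hypothesis gives \<open>V A\<^sub>j = H N A\<^sub>j\<close>.\<close>
      have V_HNB: "\<exists>x\<in>H <#> N. \<exists>b\<in>B. v = x \<otimes> b" if v: "v \<in> V" for v
      proof -
        define W where "W = V <#> A j"
        define NA where "NA = N <#> A j"
        note W = normalises_set_mult[OF norA[OF V(1), of j], folded W_def]
        note NA = normalises_set_mult[OF norA[OF sN, of j], folded NA_def]
        have sA: "subgroup (A j) G"
          using normal_imp_subgroup[OF Anor] .
        have NAW: "NA \<subseteq> W"
          using mono_set_mult[of N V "A j" "A j"] N(2) by (simp add: NA_def W_def)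
        have norVNA: "normalises V NA"
        proof -
          have "v \<otimes> x \<otimes> inv v \<in> NA" if v: "v \<in> V" and x: "x \<in> NA" for v x
          proof -
            obtain n a where na: "n \<in> N" "a \<in> A j" "x = n \<otimes> a"
              using x by (auto simp: NA_def set_mult_iff)
            have "v \<otimes> n \<otimes> inv v \<in> N" "v \<otimes> a \<otimes> inv v \<in> A j"
              using N(1) norA[OF V(1), of j] v na by (auto simp: normalises_def)
            moreover have "v \<otimes> x \<otimes> inv v = (v \<otimes> n \<otimes> inv v) \<otimes> (v \<otimes> a \<otimes> inv v)"
            proof -
              have "v \<in> carrier G" "n \<in> carrier G" "a \<in> carrier G"
                using v na subgroup.subset[OF sA] by auto
              then show ?thesis
                by (simp add: na(3) m_assoc) (simp add: m_assoc[symmetric])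
            qed
            ultimately show ?thesis
              unfolding NA_def set_mult_iff by blast
          qed
          then show ?thesis
            using V(1) NA(1) by (simp add: normalises_def)
        qed
        have norWNA: "normalises W NA"
          unfolding W_def
        proof (rule set_mult_normalises[OF norA[OF V(1)] norVNA])
          show "normalises (A j) NA"
            using normalises_subgroup[OF normalises_self[OF NA(1)] sA NA(3)] .
        qed
        have "quotient_in V (V \<inter> NA)"
          using quotient_in_mono[of V N "V \<inter> NA"] VN N NA(2)
            normalises_Int[OF normalises_self[OF V(1)] norVNA] by auto
        then have "quotient_in (V <#> NA) NA"
          using quotient_in_second_iso[OF norVNA] by simp
        moreover have "V <#> NA = W"
        proof
          show "V <#> NA \<subseteq> W"
            using set_mult_subset_subgroup[OF W(1,2) NAW] .
          show "W \<subseteq> V <#> NA"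
            using mono_set_mult[of V V "A j" NA] NA(3) by (simp add: W_def)
        qed
        ultimately have "H <#> NA = W"
          using Suc.IH W NA NAW norWNA V(2) by blast
        then obtain h x where hx: "h \<in> H" "x \<in> NA" "v = h \<otimes> x"
          using v W(2) set_mult_iff[of v H NA] by blast
        then obtain n a where na: "n \<in> N" "a \<in> A j" "x = n \<otimes> a"
          by (auto simp: NA_def set_mult_iff)
        have carr: "h \<in> carrier G" "n \<in> carrier G" "a \<in> carrier G"
          using hx na subgroup.subset[OF sA] by auto
        have eq: "v = (h \<otimes> n) \<otimes> a"
          using hx na carr by (simp add: m_assoc)
        have hn: "h \<otimes> n \<in> H <#> N"
          using hx na by (auto simp: set_mult_iff)
        have "a = inv (h \<otimes> n) \<otimes> v"
          using eq carr by (simp add: inv_solve_left)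
        then have "a \<in> B"
          using hn HNV v na(2) V.m_inv_closed unfolding B_def by blast
        then show ?thesis
          using eq hn by blast
      qed
      define Y where "Y = H <#> B"
      have norHB: "normalises H B"
        using normalises_subgroup[OF norB H V(2)] .
      note Y = normalises_set_mult[OF norHB, folded Y_def]
      have BV: "B \<subseteq> V"
        by (auto simp: B_def)
      have YV: "Y \<subseteq> V"
        using set_mult_subset_subgroup[OF V BV] by (simp add: Y_def)
      have norY: "normalises Y X" if "normalises V X" for X
        using normalises_subgroup[OF that Y(1) YV] .
      define B0 where "B0 = N \<inter> B"
      have norB0: "normalises Y B0"
        unfolding B0_def using normalises_Int[OF norY[OF N(1)] norY[OF norB]] .
      have B0Y: "B0 \<subseteq> Y"
        using Y(3) by (auto simp: B0_def)
      have YN: "Y <#> N = V"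
      proof
        show "Y <#> N \<subseteq> V"
          using set_mult_subset_subgroup[OF V(1) YV N(2)] .
        show "V \<subseteq> Y <#> N"
        proof
          fix v assume "v \<in> V"
          then obtain x b where xb: "x \<in> H <#> N" "b \<in> B" "v = x \<otimes> b"
            using V_HNB by blast
          have sub: "subgroup (Y <#> N) G" "Y \<subseteq> Y <#> N" "N \<subseteq> Y <#> N"
            using normalises_set_mult[OF norY[OF N(1)]] by auto
          then have "x \<in> Y <#> N"
            using set_mult_subset_subgroup[of "Y <#> N" H N] Y(2) xb(1) by blast
          then show "v \<in> Y <#> N"
            using xb sub Y(3) by (auto intro: subgroup.m_closed)
        qed
      qed
      have "quotient_in Y (Y \<inter> N)"
        using quotient_in_second_iso[OF norY[OF N(1)]] VN YN by simp
      moreover have "quotient_in Y B"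
      proof -
        have "\<one> \<in> B"
          using norB by (simp add: normalises_def subgroup.one_closed)
        then have "quotient_in H (H \<inter> B)"
          using quotient_in_mono[of H "{\<one>}" "H \<inter> B"] HF
            normalises_Int[OF normalises_self[OF H] norHB]
            normalises_subgroup[OF one_is_normal[unfolded normal_iff_normalises] H H.subset]
          by auto
        then show ?thesis
          using quotient_in_second_iso[OF norHB] by (simp add: Y_def)
      qed
      ultimately have "quotient_in Y (Y \<inter> N \<inter> B)"
        using quotient_in_Int normalises_Int[OF normalises_self[OF Y(1)] norY[OF N(1)]]
          norY[OF norB] Y(3) by simp
      moreover have "Y \<inter> N \<inter> B = B0"
        using Y(3) by (auto simp: B0_def)
      ultimately have YB0: "quotient_in Y B0"
        by simp
      define HZ where "HZ = H <#> Z"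
      note HZ = normalises_set_mult[OF norZ[OF H], folded HZ_def]
      have ZB: "Z \<subseteq> B"
        using ZA ZN N(2) by (auto simp: B_def Z_def)
      have HZB: "HZ <#> B = Y"
      proof
        show "HZ <#> B \<subseteq> Y"
          using set_mult_subset_subgroup[OF Y(1)] Y(2,3) ZB by (simp add: HZ_def)
        show "Y \<subseteq> HZ <#> B"
          using mono_set_mult[of H HZ B B] HZ(2) by (simp add: Y_def)
      qed
      have "Z \<lhd> G"
        using Anor by (simp add: Z_def)
      have "HZ <#> B0 = Y"
      proof (intro maximal_in_class_supplements[OF Y(1) HZ(1) norY[OF norB] norZ[OF Y(1)] norB0 _ _ _ HZ(3) HZB YB0])
        show "Z \<subseteq> B0" "B0 \<subseteq> B"
          using ZB ZN by (auto simp: B0_def Z_def)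
        show "x \<otimes> y \<otimes> inv x \<otimes> inv y \<in> Z" if "x \<in> B" "y \<in> B" for x y
          using comm that by (simp add: B_def)
        show "quotient_in HZ Z"
          using projF[OF \<open>Z \<lhd> G\<close>] by (simp add: HZ_def)
        show "U = HZ" if "subgroup U G" "HZ \<subseteq> U" "quotient_in U Z" for U
          using projmax[OF \<open>Z \<lhd> G\<close> that(1) _ that(3)] that(2) by (simp add: HZ_def)
      qed
      have "B \<subseteq> H <#> N"
      proof -
        have sub: "subgroup (H <#> N) G" "H \<subseteq> H <#> N" "N \<subseteq> H <#> N"
          using normalises_set_mult[OF norHN] by auto
        moreover have "HZ \<subseteq> H <#> N"
          unfolding HZ_def using set_mult_subset_subgroup[OF sub(1,2)] sub(3) ZN Z_def by auto
        ultimately have "HZ <#> B0 \<subseteq> H <#> N"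
          using set_mult_subset_subgroup[of "H <#> N" HZ B0] by (auto simp: B0_def)
        then show ?thesis
          using \<open>HZ <#> B0 = Y\<close> Y(3) by simp
      qed
      have "v \<in> H <#> N" if v: "v \<in> V" for v
      proof -
        obtain x b where "x \<in> H <#> N" "b \<in> B" "v = x \<otimes> b"
          using V_HNB[OF v] by blast
        then show ?thesis
          using \<open>B \<subseteq> H <#> N\<close> subgroup.m_closed[OF normalises_set_mult(1)[OF norHN]] by auto
      qed
      then show "H <#> N = V"
        using HNV by blast
    qed
  qed
  obtain n where "A n = {\<one>}"
    using solvable_imp_trivial_derived_seq assms(2) by (auto simp: A_def solvable_def)
  moreover have "subgroup N G"
    using N(1) by (simp add: normalises_def)
  ultimately have "A n \<subseteq> N"
    using subgroup.one_closed[of N G] by simp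
  then show ?thesis
    using step[of n] V N VN by blast
qed

lemma residual_subgroup:
  assumes X: "subgroup X G" and N: "normalises X N" "N \<subseteq> X" "quotient_in X N"
  defines "R \<equiv> residual F (G\<lparr>carrier := X\<rparr>)"
  shows "normalises X R" "R \<subseteq> X" "quotient_in X R"
    and "\<And>M. normalises X M \<Longrightarrow> M \<subseteq> X \<Longrightarrow> quotient_in X M \<Longrightarrow> R \<subseteq> M"
proof -
  define P where "P M \<longleftrightarrow> normalises X M \<and> M \<subseteq> X \<and> quotient_in X M" for M
  obtain M where M: "P M" and min: "\<And>U. P U \<Longrightarrow> U \<subseteq> M \<Longrightarrow> U = M"
  proof (rule obtain_minimal_subgroup)
    show "P N"
      using N by (simp add: P_def)
    show "subgroup U G" if "P U" for U
      using that by (simp add: P_def normalises_def)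
  qed blast
  have least: "M \<subseteq> U" if "P U" for U
  proof -
    have "P (M \<inter> U)"
      using M that normalises_Int[of X M U] quotient_in_Int[of X M U] by (auto simp: P_def)
    then show ?thesis
      using min[of "M \<inter> U"] by blast
  qed
  have "R = (LEAST N. P N)"
    by (simp add: R_def residual_def P_def normal_subgroup_iff_normalises[OF X] conj_assoc)
  also have "\<dots> = M"
    using M least by (rule Least_equality)
  finally have "R = M" .
  then show "normalises X R" "R \<subseteq> X" "quotient_in X R"
    and "\<And>U. normalises X U \<Longrightarrow> U \<subseteq> X \<Longrightarrow> quotient_in X U \<Longrightarrow> R \<subseteq> U"
    using M least by (auto simp: P_def)
qed

end

section \<open>The chain of residuals and derived subgroups\<close>

locale projector_group = formation_group +
  fixes H :: "'a set"
  assumes solvable: "solvable G" and projector: "projector F G H"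
begin

lemma subgroup_H: "subgroup H G"
  using projector by (simp add: projector_def)

lemma quotient_in_H:
  assumes "normalises H N" "N \<subseteq> H"
  shows "quotient_in H N"
proof -
  interpret H: subgroup H G by (rule subgroup_H)
  have "H <#> {\<one>} = H"
    by (simp add: set_mult_def)
  then have "quotient_in H {\<one>}"
    using projector one_is_normal unfolding projector_def by metis
  moreover have "\<one> \<in> N"
    using assms(1) by (simp add: normalises_def subgroup.one_closed)
  ultimately show ?thesis
    using quotient_in_mono[OF normalises_one[OF subgroup_H] assms(1) _ assms(2)] by simp
qed

text \<open>
  \<open>K\<close> is the residual of \<open>K H\<close>. All \<open>K\<^sub>i\<close> have this property; it mentions no index, so that one step
  of the chain can be described once and for all.
\<close>

definition chain_step :: "'a set \<Rightarrow> bool" where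
  "chain_step K \<longleftrightarrow> normalises (K <#> H) K \<and> H \<subseteq> K <#> H \<and> K \<subseteq> K <#> H \<and>
     (\<forall>N. normalises (K <#> H) N \<longrightarrow> N \<subseteq> K <#> H \<longrightarrow> quotient_in (K <#> H) N \<longrightarrow> K \<subseteq> N)"

lemma chain_step_residual:
  assumes X: "subgroup X G" "H \<subseteq> X" and N: "normalises X N" "N \<subseteq> X" "quotient_in X N"
  defines "R \<equiv> residual F (G\<lparr>carrier := X\<rparr>)"
  shows "chain_step R" "R <#> H = X" "R \<subseteq> N"
proof -
  note R = residual_subgroup[OF X(1) N, folded R_def]
  have HR: "normalises H R"
    using normalises_subgroup[OF R(1) subgroup_H X(2)] .
  show RH: "R <#> H = X"
    using projector_in_subgroup[OF projector solvable X R(1-3)] normalises_set_mult(4)[OF HR] by simp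
  show "R \<subseteq> N"
    using R(4) N by blast
  show "chain_step R"
    unfolding chain_step_def RH using R X by blast
qed

text \<open>The quotient of \<open>K' H\<close> by \<open>K'\<close> is a quotient of \<open>H\<close>, so the residual of \<open>K' H\<close> is contained in \<open>K'\<close>.\<close>

lemma chain_step_derived:
  assumes "chain_step K"
  shows "normalises (K <#> H) (derived G K)" "derived G K \<subseteq> K"
    and "subgroup (derived G K <#> H) G" "H \<subseteq> derived G K <#> H"
    and "normalises (derived G K <#> H) (derived G K)" "derived G K \<subseteq> derived G K <#> H"
    and "quotient_in (derived G K <#> H) (derived G K)"
proof -
  define X where "X = K <#> H"
  have K: "normalises X K" "K \<subseteq> X" and HX: "H \<subseteq> X"
    using assms by (simp_all add: chain_step_def X_def)
  have X: "subgroup X G" and sK: "subgroup K G"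
    using K(1) by (simp_all add: normalises_def)
  let ?D = "derived G K"
  interpret X: group "G\<lparr>carrier := X\<rparr>"
    using subgroup_imp_group[OF X] .
  show DK: "?D \<subseteq> K"
    using derived_incl[OF subset_refl sK] .
  have "derived (G\<lparr>carrier := X\<rparr>) K \<lhd> G\<lparr>carrier := X\<rparr>"
    using X.derived_is_normal K X by (simp add: normal_subgroup_iff_normalises)
  then show XD: "normalises (K <#> H) ?D"
    using derived_consistent[OF K(2) X] X X_def by (simp add: normal_subgroup_iff_normalises)
  then have HD: "normalises H ?D"
    using normalises_subgroup subgroup_H HX X_def by blast
  note D = normalises_set_mult[OF HD]
  have sD: "subgroup ?D G"
    using HD by (simp add: normalises_def)
  show "subgroup (?D <#> H) G" "H \<subseteq> ?D <#> H" "?D \<subseteq> ?D <#> H"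
    using D by auto
  show "normalises (?D <#> H) ?D"
    using set_mult_normalises[OF HD HD normalises_self[OF sD]] D(4) by simp
  have "quotient_in H (H \<inter> ?D)"
    using quotient_in_H normalises_Int[OF normalises_self[OF subgroup_H] HD] by simp
  then show "quotient_in (?D <#> H) ?D"
    using quotient_in_second_iso[OF HD] D(4) by simp
qed

abbreviation K where "K \<equiv> chain_K F G H"
abbreviation L where "L \<equiv> chain_L F G H"
abbreviation m where "m \<equiv> chain_length F G H"

lemma quotient_in_carrier: "quotient_in (carrier G) (carrier G)"
proof -
  have "normalises H (carrier G)"
    using normalises_subgroup[OF normalises_self[OF subgroup_self] subgroup_H]
      subgroup.subset[OF subgroup_H] .
  then have "H <#> carrier G = carrier G"
    using set_mult_carrier_idem[OF subgroup_H] normalises_set_mult(4)[of H "carrier G"] by auto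
  moreover have "carrier G \<lhd> G"
    by (rule normal_self)
  ultimately show ?thesis
    using projector unfolding projector_def by metis
qed

lemma chain_step_K: "chain_step (K i)"
proof (induction i)
  case 0
  then show ?case
    using chain_step_residual(1)[OF subgroup_self subgroup.subset[OF subgroup_H]
        normalises_self[OF subgroup_self] subset_refl quotient_in_carrier] by simp
next
  case (Suc i)
  then show ?case
    using chain_step_residual(1)[OF chain_step_derived(3-7)[OF Suc]] by simp
qed

lemma K_0_H: "K 0 <#> H = carrier G"
  using chain_step_residual(2)[OF subgroup_self subgroup.subset[OF subgroup_H]
      normalises_self[OF subgroup_self] subset_refl quotient_in_carrier] by simp

declare chain_K.simps [simp del]

lemma K_Suc_H: "K (Suc i) <#> H = L i <#> H"
  and K_Suc_subset_L: "K (Suc i) \<subseteq> L i"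
  using chain_step_residual(2,3)[OF chain_step_derived(3-7)[OF chain_step_K[of i]]]
  by (simp_all add: chain_L_def chain_K.simps)

lemma L_subset_K: "L i \<subseteq> K i"
  using chain_step_derived(2)[OF chain_step_K] by (simp add: chain_L_def)

lemma K_normal: "normalises (K i <#> H) (K i)" "K i \<subseteq> K i <#> H" "H \<subseteq> K i <#> H"
  using chain_step_K[of i] by (auto simp: chain_step_def)

lemma L_normal: "normalises (K i <#> H) (L i)" "L i \<subseteq> L i <#> H"
  using chain_step_derived(1,6)[OF chain_step_K] by (simp_all add: chain_L_def)

lemma subgroup_K: "subgroup (K i) G" "subgroup (K i <#> H) G" "subgroup (L i) G"
  using K_normal(1)[of i] L_normal(1)[of i] by (auto simp: normalises_def)

text \<open>\<open>K\<^sub>i\<close> lies in the \<open>i\<close>-th derived subgroup of \<open>G\<close>, hence the chain does reach \<open>H\<close>.\<close>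

lemma K_length_H: "K m <#> H = H"
proof -
  have "K i \<subseteq> (derived G ^^ i) (carrier G)" for i
  proof (induction i)
    case 0
    then show ?case
      using subgroup.subset[OF subgroup_K(1)[of 0]] by simp
  next
    case (Suc i)
    then show ?case
      using K_Suc_subset_L[of i] mono_derived[OF Suc] by (auto simp: chain_L_def)
  qed
  moreover obtain n where "(derived G ^^ n) (carrier G) = {\<one>}"
    using solvable_imp_trivial_derived_seq solvable by (auto simp: solvable_def)
  ultimately have "K n \<subseteq> {\<one>}"
    by metis
  then have "K n \<subseteq> H"
    using subgroup.one_closed[OF subgroup_H] by blast
  then have "K n <#> H = H"
    using K_normal(3)[of n] set_mult_subset_subgroup[OF subgroup_H, of "K n" H] by blast
  then show ?thesis
    unfolding chain_length_def by (rule LeastI)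
qed

lemma K_length: "K m = {\<one>}"
proof -
  have "K m \<subseteq> {\<one>}"
    using chain_step_K[of m] quotient_in_H[OF normalises_one] subgroup.one_closed[OF subgroup_H]
      normalises_one[OF subgroup_H] subgroup_H
    by (simp add: chain_step_def K_length_H)
  then show ?thesis
    using subgroup.one_closed[OF subgroup_K(1)] by auto
qed

end

section \<open>Characters along the chain\<close>

lemma restrict_restrict_subset: "B \<subseteq> A \<Longrightarrow> restrict (restrict f A) B = restrict f B"
  by (auto simp: restrict_def fun_eq_iff)

lemma lies_over_restrict: "N \<subseteq> M \<Longrightarrow> lies_over N (restrict \<psi> M) \<phi> \<longleftrightarrow> lies_over N \<psi> \<phi>"
  by (simp only: lies_over_def restrict_restrict_subset)

context formation_group
begin

lemma Irr_restrict_larger: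
  assumes X: "subgroup X G" and M: "subgroup M G" and U: "subgroup U G" "M \<subseteq> U" "U \<subseteq> X"
    and "\<psi> \<in> Irr (G\<lparr>carrier := X\<rparr>)" "restrict \<psi> M \<in> Irr (G\<lparr>carrier := M\<rparr>)"
  shows "restrict \<psi> U \<in> Irr (G\<lparr>carrier := U\<rparr>)"
  using Irr_restrict_intermediate[of "G\<lparr>carrier := X\<rparr>" M U \<psi>] assms
    subgroup_imp_group[OF X] finite_subgroup[OF X] subgroup_incl[OF M X] subgroup_incl[OF U(1) X]
  by auto

lemma normal_pairI:
  assumes "subgroup M G" "normalises M N" "N \<subseteq> M" "\<phi> \<in> Irr (G\<lparr>carrier := N\<rparr>)"
    and "\<theta> \<in> Irr (G\<lparr>carrier := M\<rparr>)" "lies_over N \<theta> \<phi>"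
  shows "normal_pair G (N, \<phi>) (M, \<theta>)"
  using assms by (simp add: normal_pair_def normal_subgroup_iff_normalises Irr_over_def)

lemma lies_over_restriction:
  assumes "subgroup N G" "restrict \<psi> N = \<theta>" "\<theta> \<in> Irr (G\<lparr>carrier := N\<rparr>)"
  shows "lies_over N \<psi> \<theta>"
  using lies_over_restrict_Irr[OF subgroup_imp_group finite_subgroup] assms by blast

end

context projector_group
begin

lemma Irr_F'_step_below:
  assumes "i < m"
  shows "\<psi> \<in> Irr_F'_step F G H i \<longleftrightarrow>
    \<psi> \<in> Irr (G\<lparr>carrier := K i <#> H\<rparr>) \<and> restrict \<psi> (K i) \<in> Irr (G\<lparr>carrier := K i\<rparr>) \<and>
    (\<exists>\<psi>'\<in>Irr_F'_step F G H (Suc i). lies_over (L i) \<psi> (restrict \<psi>' (L i)))"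
  using assms by (subst Irr_F'_step.simps) (auto simp: Let_def Irr_over_set_def Irr_over_def)

lemma Irr_F'_step_length: "Irr_F'_step F G H m = Lin (G\<lparr>carrier := K m <#> H\<rparr>)"
  by (subst Irr_F'_step.simps) (simp add: K_length_H)

lemma Lin_iff_trivial_on_last:
  assumes "\<psi> \<in> Irr (G\<lparr>carrier := K m <#> H\<rparr>)"
  shows "restrict \<psi> (K m) = trivial_character (K m) \<longleftrightarrow> \<psi> \<in> Lin (G\<lparr>carrier := K m <#> H\<rparr>)"
  using assms by (auto simp: K_length trivial_character_def Lin_def fun_eq_iff restrict_def)

lemma Irr_F'_step_irreducible:
  assumes "i \<le> m" "\<psi> \<in> Irr_F'_step F G H i"
  shows "\<psi> \<in> Irr (G\<lparr>carrier := K i <#> H\<rparr>)" "restrict \<psi> (K i) \<in> Irr (G\<lparr>carrier := K i\<rparr>)"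
proof -
  have "\<psi> \<in> Irr (G\<lparr>carrier := K i <#> H\<rparr>) \<and> restrict \<psi> (K i) \<in> Irr (G\<lparr>carrier := K i\<rparr>)"
  proof (cases "i = m")
    case True
    then have Lin: "\<psi> \<in> Lin (G\<lparr>carrier := K i <#> H\<rparr>)"
      using assms(2) Irr_F'_step_length by simp
    then have Irr: "\<psi> \<in> Irr (G\<lparr>carrier := K i <#> H\<rparr>)"
      by (simp add: Lin_def)
    then show ?thesis
      using Lin_iff_trivial_on_last Lin trivial_character_Irr_one[OF group_axioms] True K_length by metis
  next
    case False
    then show ?thesis
      using assms Irr_F'_step_below by auto
  qed
  then show "\<psi> \<in> Irr (G\<lparr>carrier := K i <#> H\<rparr>)" "restrict \<psi> (K i) \<in> Irr (G\<lparr>carrier := K i\<rparr>)"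
    by auto
qed

text \<open>The inclusion \<open>\<Delta>\<^sub>i \<subseteq> Irr(L\<^sub>i)\<close>, because \<open>\<psi>\<close> is irreducible already on \<open>K\<^bsub>i+1\<^esub> \<subseteq> L\<^sub>i\<close>.\<close>

lemma Irr_F'_step_restrict_L:
  assumes "i < m" "\<psi> \<in> Irr_F'_step F G H (Suc i)"
  shows "restrict \<psi> (L i) \<in> Irr (G\<lparr>carrier := L i\<rparr>)"
proof (rule Irr_restrict_larger[OF subgroup_K(2)[of "Suc i"] subgroup_K(1) subgroup_K(3) K_Suc_subset_L])
  show "L i \<subseteq> K (Suc i) <#> H"
    using L_normal(2) K_Suc_H by simp
qed (use assms Irr_F'_step_irreducible[of "Suc i"] in auto)

text \<open>The conditions that drive the downward induction in the converse direction.\<close>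

definition admissible_chain :: "(nat \<Rightarrow> 'a \<Rightarrow> complex) \<Rightarrow> (nat \<Rightarrow> 'a \<Rightarrow> complex) \<Rightarrow> bool" where
  "admissible_chain \<phi> \<theta> \<longleftrightarrow>
     \<theta> m = trivial_character (K m) \<and>
     (\<forall>i<m. \<theta> i \<in> Irr (G\<lparr>carrier := K i\<rparr>) \<and> lies_over (L i) (\<theta> i) (\<phi> i) \<and>
        extends_to (G\<lparr>carrier := L i <#> H\<rparr>) (L i) (\<phi> i) \<and>
        restrict (\<phi> i) (K (Suc i)) = \<theta> (Suc i))"

text \<open>
  Any extension of \<open>\<phi>\<^sub>i\<close> to \<open>L\<^sub>i H = K\<^bsub>i+1\<^esub> H\<close> restricts to \<open>\<theta>\<^bsub>i+1\<^esub>\<close>, so the induction hypothesis applies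
  to it and shows \<open>\<phi>\<^sub>i \<in> \<Delta>\<^sub>i\<close>.
\<close>

lemma extension_in_Irr_F'_step:
  assumes adm: "admissible_chain \<phi> \<theta>" and "i \<le> m"
  shows "\<forall>\<psi>\<in>Irr (G\<lparr>carrier := K i <#> H\<rparr>). restrict \<psi> (K i) = \<theta> i \<longrightarrow> \<psi> \<in> Irr_F'_step F G H i"
  using assms(2)
proof (induction i rule: inc_induct)
  case base
  show ?case
    using adm Lin_iff_trivial_on_last Irr_F'_step_length by (metis admissible_chain_def)
next
  case (step i)
  have i: "\<theta> i \<in> Irr (G\<lparr>carrier := K i\<rparr>)" "lies_over (L i) (\<theta> i) (\<phi> i)"
      "extends_to (G\<lparr>carrier := L i <#> H\<rparr>) (L i) (\<phi> i)" "restrict (\<phi> i) (K (Suc i)) = \<theta> (Suc i)"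
    using adm step.hyps by (auto simp: admissible_chain_def)
  obtain \<psi>' where \<psi>': "\<psi>' \<in> Irr (G\<lparr>carrier := K (Suc i) <#> H\<rparr>)" "restrict \<psi>' (L i) = \<phi> i"
    using i(3) by (auto simp: extends_to_def K_Suc_H)
  have "restrict \<psi>' (K (Suc i)) = \<theta> (Suc i)"
    using restrict_restrict_subset[OF K_Suc_subset_L, of \<psi>' i] \<psi>'(2) i(4) by simp
  then have \<psi>'_step: "\<psi>' \<in> Irr_F'_step F G H (Suc i)"
    using step.IH \<psi>'(1) by blast
  show ?case
  proof (intro ballI impI)
    fix \<psi> assume \<psi>: "\<psi> \<in> Irr (G\<lparr>carrier := K i <#> H\<rparr>)" "restrict \<psi> (K i) = \<theta> i"
    have "lies_over (L i) \<psi> (\<phi> i)"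
      using i(2) lies_over_restrict[OF L_subset_K] \<psi>(2) by metis
    then show "\<psi> \<in> Irr_F'_step F G H i"
      unfolding Irr_F'_step_below[OF step.hyps(2)] using \<psi> i(1) \<psi>'(2) \<psi>'_step by metis
  qed
qed

text \<open>The recursion unfolded: each \<open>\<psi>\<^bsub>i+1\<^esub>\<close> is a witness for \<open>\<psi>\<^sub>i\<close> lying over \<open>\<Delta>\<^sub>i\<close>.\<close>

lemma Irr_F'_step_obtain_chain:
  assumes "\<chi> \<in> Irr_F'_step F G H 0"
  obtains \<psi> where "\<psi> 0 = \<chi>" "\<And>i. i \<le> m \<Longrightarrow> \<psi> i \<in> Irr_F'_step F G H i"
    and "\<And>i. i < m \<Longrightarrow> lies_over (L i) (\<psi> i) (restrict (\<psi> (Suc i)) (L i))"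
proof -
  define P where "P i \<psi> \<psi>' \<longleftrightarrow> \<psi>' \<in> Irr_F'_step F G H (Suc i) \<and> lies_over (L i) \<psi> (restrict \<psi>' (L i))" for i \<psi> \<psi>'
  define \<psi> where "\<psi> = rec_nat \<chi> (\<lambda>i \<psi>. SOME \<psi>'. P i \<psi> \<psi>')"
  have succ: "P i (\<psi> i) (\<psi> (Suc i))" if "i < m" "\<psi> i \<in> Irr_F'_step F G H i" for i
  proof -
    have "\<exists>\<psi>'. P i (\<psi> i) \<psi>'"
      using Irr_F'_step_below[OF that(1)] that(2) by (auto simp: P_def)
    then show ?thesis
      by (simp add: \<psi>_def someI_ex)
  qed
  have mem: "\<psi> i \<in> Irr_F'_step F G H i" if "i \<le> m" for i
    using that
  proof (induction i)
    case 0
    then show ?case using assms by (simp add: \<psi>_def)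
  next
    case (Suc i)
    then show ?case using succ[of i] by (simp add: P_def)
  qed
  show thesis
  proof (rule that[of \<psi>])
    show "\<psi> 0 = \<chi>" by (simp add: \<psi>_def)
  qed (use mem succ in \<open>auto simp: P_def\<close>)
qed

end

theorem theorem4p1:
  fixes F :: "nat monoid set"
    and G :: "('a, 'b) monoid_scheme"
    and H :: "'a set"
    and \<chi> :: "'a \<Rightarrow> complex"
    and K L :: "nat \<Rightarrow> 'a set"
    and m :: nat
  assumes "saturated_formation F"
    and "finite_nilpotent_groups \<subseteq> F"
    and "group G" and "finite (carrier G)" and "solvable G"
    and "projector F G H"
    and "K = chain_K F G H" and "L = chain_L F G H" and "m = chain_length F G H"
    and "\<chi> \<in> Irr G"
  shows "\<chi> \<in> Irr_F' F G H \<longleftrightarrow>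
    restrict \<chi> (K 0) \<in> Irr (G\<lparr>carrier := K 0\<rparr>) \<and>
    (\<exists>\<phi> \<theta>.
       \<theta> 0 = restrict \<chi> (K 0) \<and>
       \<theta> m = trivial_character (K m) \<and>
       (\<forall>i<m. \<phi> i \<in> Irr (G\<lparr>carrier := L i\<rparr>) \<and>
              \<theta> i \<in> Irr_over (G\<lparr>carrier := K i\<rparr>) (L i) (\<phi> i) \<and>
              extends_to (G\<lparr>carrier := L i <#>\<^bsub>G\<^esub> H\<rparr>) (L i) (\<phi> i) \<and>
              extends_to (G\<lparr>carrier := K i <#>\<^bsub>G\<^esub> H\<rparr>) (K i) (\<theta> i)) \<and>
       K m = {\<one>\<^bsub>G\<^esub>} \<and>
       (\<forall>i<m. normal_pair G (K (Suc i), \<theta> (Suc i)) (L i, \<phi> i) \<and>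
              normal_pair G (L i, \<phi> i) (K i, \<theta> i)) \<and>
       normal_pair G (K 0, \<theta> 0) (K 0 <#>\<^bsub>G\<^esub> H, \<chi>) \<and>
       K 0 <#>\<^bsub>G\<^esub> H = carrier G \<and>
       (\<forall>i<m. restrict (\<phi> i) (K (Suc i)) = \<theta> (Suc i)))"
    (is "_ \<longleftrightarrow> ?irr \<and> (\<exists>\<phi> \<theta>. ?chain \<phi> \<theta>)")
proof -
  interpret projector_group G F H
    using assms by (simp add: projector_group_def projector_group_axioms_def
        formation_group_def formation_group_axioms_def)
  note defs = assms(7-9)
  have \<chi>: "\<chi> \<in> Irr (G\<lparr>carrier := K 0 <#>\<^bsub>G\<^esub> H\<rparr>)"
    using assms(10) K_0_H defs by simp
  show ?thesis
  proof
    assume "\<chi> \<in> Irr_F' F G H"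
    then obtain \<psi> where \<psi>: "\<psi> 0 = \<chi>" "\<And>i. i \<le> m \<Longrightarrow> \<psi> i \<in> Irr_F'_step F G H i"
      and over: "\<And>i. i < m \<Longrightarrow> lies_over (L i) (\<psi> i) (restrict (\<psi> (Suc i)) (L i))"
      using Irr_F'_step_obtain_chain[of \<chi>] defs unfolding Irr_F'_def by metis
    define \<theta> where "\<theta> i = restrict (\<psi> i) (K i)" for i
    define \<phi> where "\<phi> i = restrict (\<psi> (Suc i)) (L i)" for i
    have \<psi>_Irr: "\<psi> i \<in> Irr (G\<lparr>carrier := K i <#>\<^bsub>G\<^esub> H\<rparr>)"
      and \<theta>_Irr: "\<theta> i \<in> Irr (G\<lparr>carrier := K i\<rparr>)" if "i \<le> m" for i
      using Irr_F'_step_irreducible[of i "\<psi> i"] \<psi>(2)[OF that] that by (auto simp: \<theta>_def defs)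
    have \<phi>_Irr: "\<phi> i \<in> Irr (G\<lparr>carrier := L i\<rparr>)" if "i < m" for i
      using Irr_F'_step_restrict_L[of i "\<psi> (Suc i)"] \<psi>(2)[of "Suc i"] that by (simp add: \<phi>_def defs)
    have \<theta>_over: "lies_over (L i) (\<theta> i) (\<phi> i)" if "i < m" for i
      using over[OF that] lies_over_restrict[OF L_subset_K] by (simp add: \<theta>_def \<phi>_def defs)
    have \<phi>_restrict: "restrict (\<phi> i) (K (Suc i)) = \<theta> (Suc i)" for i
      using restrict_restrict_subset[OF K_Suc_subset_L] by (simp add: \<theta>_def \<phi>_def defs)
    have "\<theta> m = trivial_character (K m)"
      using Lin_iff_trivial_on_last[of "\<psi> m"] \<psi>(2)[of m] \<psi>_Irr[of m] Irr_F'_step_length by (simp add: \<theta>_def defs)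
    moreover have "extends_to (G\<lparr>carrier := L i <#>\<^bsub>G\<^esub> H\<rparr>) (L i) (\<phi> i)" if "i < m" for i
      using \<psi>_Irr[of "Suc i"] that K_Suc_H[of i] unfolding extends_to_def \<phi>_def defs by auto
    moreover have "extends_to (G\<lparr>carrier := K i <#>\<^bsub>G\<^esub> H\<rparr>) (K i) (\<theta> i)" if "i < m" for i
      using \<psi>_Irr[of i] that unfolding extends_to_def \<theta>_def by auto
    moreover have "normal_pair G (K (Suc i), \<theta> (Suc i)) (L i, \<phi> i)" if "i < m" for i
    proof (rule normal_pairI)
      show "normalises (L i) (K (Suc i))"
        using normalises_subgroup[OF K_normal(1) subgroup_K(3)] L_normal(2) K_Suc_H defs by simp
      show "lies_over (K (Suc i)) (\<phi> i) (\<theta> (Suc i))"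
        using lies_over_restriction \<phi>_restrict subgroup_K(1) \<theta>_Irr[of "Suc i"] that defs by simp
    qed (use that subgroup_K K_Suc_subset_L \<theta>_Irr \<phi>_Irr defs in auto)
    moreover have "normal_pair G (L i, \<phi> i) (K i, \<theta> i)" if "i < m" for i
    proof (rule normal_pairI)
      show "normalises (K i) (L i)"
        using normalises_subgroup[OF L_normal(1) subgroup_K(1) K_normal(2)] defs by simp
    qed (use that subgroup_K L_subset_K \<theta>_Irr \<phi>_Irr \<theta>_over defs in auto)
    moreover have "normal_pair G (K 0, \<theta> 0) (K 0 <#>\<^bsub>G\<^esub> H, \<chi>)"
    proof (rule normal_pairI)
      show "lies_over (K 0) \<chi> (\<theta> 0)"
        using lies_over_restriction subgroup_K(1) \<theta>_Irr[of 0] \<psi>(1) by (simp add: \<theta>_def defs)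
    qed (use subgroup_K K_normal \<theta>_Irr \<chi> defs in auto)
    ultimately have "?chain \<phi> \<theta>"
      using \<theta>_Irr \<phi>_Irr \<theta>_over \<phi>_restrict K_length K_0_H \<psi>(1) defs
      by (simp add: Irr_over_def \<theta>_def)
    moreover have ?irr
      using \<theta>_Irr[of 0] \<psi>(1) by (simp add: \<theta>_def)
    ultimately show "?irr \<and> (\<exists>\<phi> \<theta>. ?chain \<phi> \<theta>)"
      by blast
  next
    assume "?irr \<and> (\<exists>\<phi> \<theta>. ?chain \<phi> \<theta>)"
    then obtain \<phi> \<theta> where chain: "?chain \<phi> \<theta>"
      by blast
    then have "admissible_chain \<phi> \<theta>"
      by (simp add: admissible_chain_def Irr_over_def defs)
    then show "\<chi> \<in> Irr_F' F G H"
      using extension_in_Irr_F'_step[of \<phi> \<theta> 0] chain \<chi> by (simp add: Irr_F'_def defs)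
  qed
qed

end
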